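(* The Lagrange spectrum $\mathscr L(\mathbf H_4)$ of the Hecke group $\mathbf H_4$ contains every real number greater than or equal to $4\sqrt2$; that is, $[4\sqrt2,\infty)\subset\mathscr L(\mathbf H_4)\subset\mathscr M(\mathbf H_4)$, where $\mathscr M(\mathbf H_4)$ is the Markoff spectrum of $\mathbf H_4$.
   Context: $\mathbf H_4$ is the subgroup of $\mathrm{PSL}_2(\mathbb R)$ generated by $S=\begin{pmatrix}0&-1\\1&0\end{pmatrix}$ and $T=\begin{pmatrix}1&\sqrt2\\0&1\end{pmatrix}$. It acts on $\hat{\mathbb R}=\mathbb R\cup\{\infty\}$ by linear fractional transformations $\begin{pmatrix}a&b\\c&d\end{pmatrix}\cdot z=\frac{az+b}{cz+d}$. The orbit of $\infty$ is $\mathbb Q(\mathbf H_4)=\sqrt2\,\mathbb Q\cup\{\infty\}$. Markoff spectrum: $\mathscr M(\mathbf H_4)$ is the set of all finite values of $\sup_{M\in\mathbf H_4}|M^{-1}\cdot\xi-M^{-1}\cdot\eta|$ over all $\xi\neq\eta$ in $\hat{\mathbb R}$ (where $|x-y|=\infty$ if exactly one of $x,y$ is $\infty$). Lagrange spectrum: for $\xi\in\mathbb R\setminus\sqrt2\,\mathbb Q$, let $L_{\mathbf H_4}(\xi)$ be the supremum of all $L>0$ such that $\left|\xi-\frac ac\right|<\frac1{Lc^2}$ holds for infinitely many points $M\cdot\infty=\frac ac$ with $M=\begin{pmatrix}a&b\\c&d\end{pmatrix}\in\mathbf H_4$, $c\ne0$. Then $\mathscr L(\mathbf H_4)$ is the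 set of all finite values $L_{\mathbf H_4}(\xi)$, $\xi\in\mathbb R\setminus\sqrt2\,\mathbb Q$. *)

theory Defs
  imports "HOL-Analysis.Analysis" "HOL-Algebra.Generated_Groups"
begin

definition SL2R :: "(real^2^2) monoid" where
  "SL2R = \<lparr>carrier = {A. det A = 1}, mult = (**), one = mat 1\<rparr>"

definition PSL2R :: "(real^2^2) set monoid" where
  "PSL2R = SL2R Mod {mat 1, - mat 1}"

definition psl_class :: "real^2^2 \<Rightarrow> (real^2^2) set" where
  "psl_class A = {mat 1, - mat 1} #>\<^bsub>SL2R\<^esub> A"

definition S_mat :: "real^2^2" where
  "S_mat = vector [vector [0, -1], vector [1, 0]]"

definition T_mat :: "real^2^2" where
  "T_mat = vector [vector [1, sqrt 2], vector [0, 1]]"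

definition H4 :: "(real^2^2) set set" where
  "H4 = generate PSL2R {psl_class S_mat, psl_class T_mat}"

(* An element of H4 is a class {M, -M}; the union of these classes consists of all matrices
   representing elements of H4. *)
definition H4_mat :: "(real^2^2) set" where
  "H4_mat = \<Union> H4"

(* The projective line R \<union> {\<infinity>}, with a single point at infinity (unlike ereal). *)
datatype rhat = Fin real | Infty

fun moebius :: "real^2^2 \<Rightarrow> rhat \<Rightarrow> rhat" where
  "moebius M (Fin x) =
     (if M$2$1 * x + M$2$2 = 0 then Infty
      else Fin ((M$1$1 * x + M$1$2) / (M$2$1 * x + M$2$2)))"
| "moebius M Infty = (if M$2$1 = 0 then Infty else Fin (M$1$1 / M$2$1))"

(* The value at (Infty, Infty) is a convention; it is never used for distinct points. *)
fun rhat_diff :: "rhat \<Rightarrow> rhat \<Rightarrow> ereal" where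
  "rhat_diff (Fin x) (Fin y) = ereal \<bar>x - y\<bar>"
| "rhat_diff (Fin x) Infty = \<infinity>"
| "rhat_diff Infty (Fin y) = \<infinity>"
| "rhat_diff Infty Infty = 0"

definition Markoff_value :: "rhat \<Rightarrow> rhat \<Rightarrow> ereal" where
  "Markoff_value \<xi> \<eta> =
     (SUP M\<in>H4_mat. rhat_diff (moebius (matrix_inv M) \<xi>) (moebius (matrix_inv M) \<eta>))"

definition Markoff_spectrum :: "real set" where
  "Markoff_spectrum = {m. \<exists>\<xi> \<eta>. \<xi> \<noteq> \<eta> \<and> Markoff_value \<xi> \<eta> = ereal m}"

definition sqrt2_rationals :: "real set" where
  "sqrt2_rationals = (\<lambda>q. sqrt 2 * q) ` \<rat>"

(* Points M\<cdot>\<infinity> = a/c are counted, not matrices. *)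
definition good_points :: "real \<Rightarrow> real \<Rightarrow> rhat set" where
  "good_points \<xi> L =
     {moebius M Infty |M. M \<in> H4_mat \<and> M$2$1 \<noteq> 0 \<and>
        \<bar>\<xi> - M$1$1 / M$2$1\<bar> < 1 / (L * (M$2$1)\<^sup>2)}"

definition Lagrange_value :: "real \<Rightarrow> ereal" where
  "Lagrange_value \<xi> = Sup {ereal L |L. L > 0 \<and> infinite (good_points \<xi> L)}"

definition Lagrange_spectrum :: "real set" where
  "Lagrange_spectrum = {l. \<exists>\<xi>. \<xi> \<notin> sqrt2_rationals \<and> Lagrange_value \<xi> = ereal l}"

lemma group_SL2R: "group SL2R"
proof (rule groupI)
  fix A assume "A \<in> carrier SL2R"
  then have d: "det A = 1" by (simp add: SL2R_def)
  then have "invertible A" by (simp add: invertible_det_nz)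
  then obtain B where B: "B ** A = mat 1" by (auto simp: invertible_def)
  then have "det B * det A = 1" by (metis det_mul det_I)
  with d B show "\<exists>B\<in>carrier SL2R. B \<otimes>\<^bsub>SL2R\<^esub> A = \<one>\<^bsub>SL2R\<^esub>"
    by (auto simp: SL2R_def)
qed (auto simp: SL2R_def det_mul matrix_mul_assoc)

lemma neg_mat_1_mult: "- mat 1 ** A = - (A :: real^2^2)" "A ** - mat 1 = - A"
  by (simp_all add: vec_eq_iff matrix_matrix_mult_def mat_def sum_2 forall_2)

lemma psl_class_eq: "psl_class A = {A, - A}"
  by (auto simp: psl_class_def r_coset_def SL2R_def neg_mat_1_mult)

lemma normal_pm1: "{mat 1, - mat 1} \<lhd> SL2R"
proof -
  interpret group SL2R by (rule group_SL2R)
  have d: "det (- mat 1 :: real^2^2) = 1" by (simp add: det_2 mat_def)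
  have n: "- mat 1 ** - mat 1 = (mat 1 :: real^2^2)" by (simp add: neg_mat_1_mult)
  have "inv\<^bsub>SL2R\<^esub> (- mat 1) = - mat 1"
    by (rule inv_equality) (auto simp: SL2R_def d n)
  moreover have "inv\<^bsub>SL2R\<^esub> (mat 1) = mat 1"
    using inv_one by (simp add: SL2R_def)
  ultimately have "subgroup {mat 1, - mat 1} SL2R"
    by unfold_locales (auto simp: SL2R_def d n)
  then show ?thesis
    by (rule normalI)
       (auto simp: r_coset_def l_coset_def SL2R_def neg_mat_1_mult)
qed

lemma group_PSL2R: "group PSL2R"
  unfolding PSL2R_def using normal_pm1 by (rule normal.factorgroup_is_group)

lemma psl_class_in_carrier: "det A = 1 \<Longrightarrow> psl_class A \<in> carrier PSL2R"
  unfolding PSL2R_def FactGroup_def RCOSETS_def psl_class_def by (auto simp: SL2R_def)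

lemma generators_in_PSL2R: "{psl_class S_mat, psl_class T_mat} \<subseteq> carrier PSL2R"
  by (simp add: psl_class_in_carrier S_mat_def T_mat_def det_2)

lemma subgroup_H4: "subgroup H4 PSL2R"
  unfolding H4_def by (rule group.generate_is_subgroup[OF group_PSL2R generators_in_PSL2R])

lemma moebius_uminus: "moebius (- M) z = moebius M z"
proof (cases z)
  case (Fin x)
  have "- (M$2$1 * x) - M$2$2 = - (M$2$1 * x + M$2$2)"
       "- (M$1$1 * x) - M$1$2 = - (M$1$1 * x + M$1$2)" by simp_all
  then show ?thesis unfolding Fin moebius.simps vector_uminus_component
    by (simp only: mult_minus_left add_uminus_conv_diff neg_equal_0_iff_equal minus_divide_divide)
qed simp

end

theory Submission
  imports Defs
begin

text \<open>
  Put \<open>\<lambda> = sqrt 2\<close>. For an element \<open>M\<close> of the Hecke group with first column \<open>(p, q)\<close>, everything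
  is governed by the form \<open>\<bar>q\<bar> * \<bar>p - q * \<xi>\<bar>\<close>: the cusp \<open>p / q\<close> is counted for \<open>L\<close> exactly when the
  form is below \<open>1 / L\<close>, and the reciprocal of the form is the distance between the images of \<open>\<xi>\<close>
  and \<open>\<infinity>\<close> under the inverse of \<open>M\<close>. The arithmetic of the group enters through one fact only
  (\<open>H4_first_columns\<close>): two first columns agree up to sign or have determinant of absolute
  value at least 1.

  Lagrange values are Markoff values (\<open>Lagrange_subset_Markoff\<close>). Choose \<open>M\<^sub>n\<close> in the group whose
  forms tend to \<open>1 / l\<close>, normalised by translations so that the images of \<open>\<infinity>\<close> stay bounded.
  A limit point \<open>(X, H)\<close> of the images of \<open>\<xi>\<close> and \<open>\<infinity>\<close> has \<open>\<bar>X - H\<bar> = l\<close>. If some group element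
  \<open>A\<close> moved \<open>X\<close> and \<open>H\<close> further apart than \<open>l\<close>, the cusps of \<open>M\<^sub>n ** A\<close> would approximate \<open>\<xi>\<close>
  with a quality above \<open>l\<close>; their errors tend to 0 without vanishing, so they would be
  infinitely many cusps, which the value \<open>l\<close> excludes.

  For the ray, consider \<open>\<xi> = \<lambda> * x\<^sub>0\<close> with \<open>x\<^sub>n = 1 / (2 * (a\<^sub>n + e\<^sub>n\<^sub>+\<^sub>1 * x\<^sub>n\<^sub>+\<^sub>1))\<close>, positive integer
  digits \<open>a\<^sub>n\<close> and signs \<open>e\<^sub>n\<close>. Its convergents are cusps of the group, and the reciprocal of the
  form at a convergent is \<open>\<lambda> * (a\<^sub>n + e\<^sub>n * past + e\<^sub>n\<^sub>+\<^sub>1 * tail)\<close>, where \<open>past\<close> is the fraction read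
  backwards from position \<open>n\<close>. Under mild rules on neighbouring digits and signs a digit at
  most 3 gives a reciprocal at most \<open>4 * \<lambda>\<close>, and any cusp whose form is below \<open>1 / (4 * \<lambda>)\<close> is a
  convergent (\<open>small_form_is_convergent\<close>). A Lagrange value of at least \<open>4 * \<lambda>\<close> can therefore be
  produced by isolated large digits alone: it is the limit superior of \<open>\<lambda> * (c + \<sigma> * x + \<tau> * y)\<close>
  over the positions of a large digit \<open>c\<close>.

  It remains to write every real \<open>\<mu> \<ge> 4\<close> as \<open>c + \<sigma> * x + \<tau> * y\<close> with an integer \<open>c \<ge> 4\<close>, signs
  \<open>\<sigma>, \<tau>\<close> and two fractions from the Cantor set \<open>C\<close> of fractions with letters \<open>(1, +)\<close>, \<open>(2, -)\<close>,
  \<open>(2, +)\<close>, \<open>(3, -)\<close>. This is the idea of Hall's theorem: in the tree of intervals defining \<open>C\<close>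
  every removed gap is at most as long as each of the two intervals it separates, hence
  \<open>C + C\<close> and \<open>C - C\<close> are whole intervals (\<open>gap_tree_sum\<close>, \<open>cantor_gap_tree\<close>), and modulo 1 the
  sets \<open>C + C\<close>, \<open>- C - C\<close> and \<open>C - C\<close> cover the line (\<open>cantor_ray\<close>). Finally, blocks consisting
  of longer and longer finite approximations to \<open>y\<close>, the digit \<open>c\<close> and \<open>x\<close> are strung together
  to one digit sequence, whose number has the Lagrange value \<open>\<lambda> * \<mu>\<close>.
\<close>

section \<open>The Hecke group as a group of matrices\<close>

definition mat2 :: "real \<Rightarrow> real \<Rightarrow> real \<Rightarrow> real \<Rightarrow> real^2^2" where
  "mat2 a b c d = vector [vector [a, b], vector [c, d]]"

lemma mat2_entries [simp]:
  "mat2 a b c d $ 1 $ 1 = a" "mat2 a b c d $ 1 $ 2 = b"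
  "mat2 a b c d $ 2 $ 1 = c" "mat2 a b c d $ 2 $ 2 = d"
  by (simp_all add: mat2_def)

lemma mat2_eq_iff: "M = mat2 a b c d \<longleftrightarrow> M$1$1 = a \<and> M$1$2 = b \<and> M$2$1 = c \<and> M$2$2 = d"
  by (auto simp: vec_eq_iff forall_2)

lemma mat2_mult: "mat2 a b c d ** mat2 a' b' c' d' =
    mat2 (a * a' + b * c') (a * b' + b * d') (c * a' + d * c') (c * b' + d * d')"
  by (simp add: vec_eq_iff forall_2 matrix_matrix_mult_def sum_2)

lemma mat2_uminus: "- mat2 a b c d = mat2 (- a) (- b) (- c) (- d)"
  by (simp add: vec_eq_iff forall_2)

lemma mat2_one: "mat 1 = mat2 1 0 0 1"
  by (simp add: vec_eq_iff forall_2 mat_def)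

lemma det_mat2: "det (mat2 a b c d) = a * d - b * c"
  by (simp add: det_2)

lemma matrix_inv_mat2:
  assumes "a * d - b * c = 1"
  shows "matrix_inv (mat2 a b c d) = mat2 d (- b) (- c) a"
proof -
  define A A' B where "A = mat2 a b c d" "A' = mat2 d (- b) (- c) a" "B = matrix_inv A"
  have 1: "A ** A' = mat 1" "A' ** A = mat 1"
    using assms by (simp_all add: A_A'_B_def mat2_mult mat2_one algebra_simps)
  then have "\<exists>X. A ** X = mat 1 \<and> X ** A = mat 1" by blast
  from someI_ex[OF this] have "A ** B = mat 1"
    by (simp add: A_A'_B_def(3) matrix_inv_def)
  then have "A' ** (A ** B) = A'" by simp
  then have "B = A'" using 1(2) by (simp only: matrix_mul_assoc matrix_mul_lid)
  then show ?thesis by (simp add: A_A'_B_def)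
qed

text \<open>The classical description of the group: its matrices come in two kinds, according to
  whether the lower left entry is an integer multiple of \<open>sqrt 2\<close> or an integer. Only the
  inclusion of the group in this set of matrices is proved below.\<close>

definition hecke_form :: "real^2^2 \<Rightarrow> bool" where
  "hecke_form M \<longleftrightarrow> (\<exists>a b c d.
     (M = mat2 (real_of_int a) (of_int b * sqrt 2) (of_int c * sqrt 2) (of_int d) \<and>
        a * d - 2 * (b * c) = 1) \<or>
     (M = mat2 (of_int a * sqrt 2) (of_int b) (of_int c) (of_int d * sqrt 2) \<and>
        2 * (a * d) - b * c = 1))"

lemma hecke_form_det: "hecke_form M \<Longrightarrow> det M = 1"
proof -
  assume "hecke_form M"
  then obtain a b c d :: int where
    "(M = mat2 a (b * sqrt 2) (c * sqrt 2) d \<and> a * d - 2 * (b * c) = 1) \<or>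
     (M = mat2 (a * sqrt 2) b c (d * sqrt 2) \<and> 2 * (a * d) - b * c = 1)"
    unfolding hecke_form_def by blast
  then show "det M = 1"
  proof (elim disjE conjE)
    assume "M = mat2 a (b * sqrt 2) (c * sqrt 2) d" "a * d - 2 * (b * c) = 1"
    moreover from this(2) have "real_of_int (a * d - 2 * (b * c)) = 1" by (simp only: of_int_1)
    ultimately show ?thesis by (simp add: det_mat2 algebra_simps)
  next
    assume "M = mat2 (a * sqrt 2) b c (d * sqrt 2)" "2 * (a * d) - b * c = 1"
    moreover from this(2) have "real_of_int (2 * (a * d) - b * c) = 1" by (simp only: of_int_1)
    ultimately show ?thesis by (simp add: det_mat2 algebra_simps)
  qed
qed

lemma hecke_form_even:
  "a * d - 2 * (b * c) = 1 \<Longrightarrow>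
   hecke_form (mat2 (of_int a) (of_int b * sqrt 2) (of_int c * sqrt 2) (of_int d))"
  unfolding hecke_form_def by blast

lemma hecke_form_odd:
  "2 * (a * d) - b * c = 1 \<Longrightarrow>
   hecke_form (mat2 (of_int a * sqrt 2) (of_int b) (of_int c) (of_int d * sqrt 2))"
  unfolding hecke_form_def by blast

lemma hecke_form_mult:
  assumes "hecke_form M" "hecke_form N"
  shows "hecke_form (M ** N)"
proof -
  have s: "sqrt 2 * (sqrt 2 * x) = 2 * x" for x :: real
    by (simp add: mult.assoc[symmetric])
  obtain a b c d :: int where M:
    "(M = mat2 a (b * sqrt 2) (c * sqrt 2) d \<and> a * d - 2 * (b * c) = (1::int)) \<or>
     (M = mat2 (a * sqrt 2) b c (d * sqrt 2) \<and> 2 * (a * d) - b * c = 1)"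
    using assms(1) unfolding hecke_form_def by blast
  obtain a' b' c' d' :: int where N:
    "(N = mat2 a' (b' * sqrt 2) (c' * sqrt 2) d' \<and> a' * d' - 2 * (b' * c') = 1) \<or>
     (N = mat2 (a' * sqrt 2) b' c' (d' * sqrt 2) \<and> 2 * (a' * d') - b' * c' = 1)"
    using assms(2) unfolding hecke_form_def by blast
  from M N show ?thesis
  proof (elim disjE conjE)
    assume h: "M = mat2 a (b * sqrt 2) (c * sqrt 2) d" "a * d - 2 * (b * c) = 1"
      "N = mat2 a' (b' * sqrt 2) (c' * sqrt 2) d'" "a' * d' - 2 * (b' * c') = 1"
    have "hecke_form (mat2 (of_int (a * a' + 2 * b * c')) (of_int (a * b' + b * d') * sqrt 2)
      (of_int (c * a' + d * c') * sqrt 2) (of_int (2 * c * b' + d * d')))"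
      by (rule hecke_form_even) (rule trans[of _ "(a * d - 2 * (b * c)) * (a' * d' - 2 * (b' * c'))"], simp add: algebra_simps, simp add: h)
    then show ?thesis by (simp add: h mat2_mult algebra_simps s)
  next
    assume h: "M = mat2 a (b * sqrt 2) (c * sqrt 2) d" "a * d - 2 * (b * c) = 1"
      "N = mat2 (a' * sqrt 2) b' c' (d' * sqrt 2)" "2 * (a' * d') - b' * c' = 1"
    have "hecke_form (mat2 (of_int (a * a' + b * c') * sqrt 2) (of_int (a * b' + 2 * b * d'))
      (of_int (2 * c * a' + d * c')) (of_int (c * b' + d * d') * sqrt 2))"
      by (rule hecke_form_odd) (rule trans[of _ "(a * d - 2 * (b * c)) * (2 * (a' * d') - b' * c')"], simp add: algebra_simps, simp add: h)
    then show ?thesis by (simp add: h mat2_mult algebra_simps s)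
  next
    assume h: "M = mat2 (a * sqrt 2) b c (d * sqrt 2)" "2 * (a * d) - b * c = 1"
      "N = mat2 a' (b' * sqrt 2) (c' * sqrt 2) d'" "a' * d' - 2 * (b' * c') = 1"
    have "hecke_form (mat2 (of_int (a * a' + b * c') * sqrt 2) (of_int (2 * a * b' + b * d'))
      (of_int (c * a' + 2 * d * c')) (of_int (c * b' + d * d') * sqrt 2))"
      by (rule hecke_form_odd) (rule trans[of _ "(2 * (a * d) - b * c) * (a' * d' - 2 * (b' * c'))"], simp add: algebra_simps, simp add: h)
    then show ?thesis by (simp add: h mat2_mult algebra_simps s)
  next
    assume h: "M = mat2 (a * sqrt 2) b c (d * sqrt 2)" "2 * (a * d) - b * c = 1"
      "N = mat2 (a' * sqrt 2) b' c' (d' * sqrt 2)" "2 * (a' * d') - b' * c' = 1"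
    have "hecke_form (mat2 (of_int (2 * a * a' + b * c')) (of_int (a * b' + b * d') * sqrt 2)
      (of_int (c * a' + d * c') * sqrt 2) (of_int (c * b' + 2 * d * d')))"
      by (rule hecke_form_even) (rule trans[of _ "(2 * (a * d) - b * c) * (2 * (a' * d') - b' * c')"], simp add: algebra_simps, simp add: h)
    then show ?thesis by (simp add: h mat2_mult algebra_simps s)
  qed
qed

lemma psl_class_mult:
  assumes "det A = 1" "det B = 1"
  shows "psl_class A \<otimes>\<^bsub>PSL2R\<^esub> psl_class B = psl_class (A ** B)"
proof -
  interpret normal "{mat 1, - mat 1}" SL2R by (rule normal_pm1)
  have "A \<in> carrier SL2R" "B \<in> carrier SL2R" using assms by (auto simp: SL2R_def)
  then show ?thesis
    using rcos_sum[of A B] by (simp add: PSL2R_def FactGroup_def psl_class_def SL2R_def)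
qed

lemma psl_class_one: "\<one>\<^bsub>PSL2R\<^esub> = psl_class (mat 1)"
  by (auto simp: PSL2R_def FactGroup_def psl_class_eq)

lemma psl_class_inv:
  assumes "det A = 1" "det B = 1" "B ** A = mat 1"
  shows "inv\<^bsub>PSL2R\<^esub> (psl_class A) = psl_class B"
  using group.inv_equality[OF group_PSL2R, of "psl_class B" "psl_class A"] assms
  by (simp add: psl_class_mult psl_class_one psl_class_in_carrier)

lemma S_mat_mat2: "S_mat = mat2 0 (-1) 1 0" by (simp add: S_mat_def mat2_def)
lemma T_mat_mat2: "T_mat = mat2 1 (sqrt 2) 0 1" by (simp add: T_mat_def mat2_def)

lemma H4_hecke:
  assumes "X \<in> H4"
  shows "\<exists>A. hecke_form A \<and> X = psl_class A"
  using assms unfolding H4_def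
proof (induction rule: generate.induct)
  case one
  have "hecke_form (mat 1)" using hecke_form_even[of 1 1 0 0] by (simp add: mat2_one)
  then show ?case using psl_class_one by blast
next
  case (incl h)
  have "hecke_form S_mat" using hecke_form_odd[of 0 0 "-1" 1] by (simp add: S_mat_mat2)
  moreover have "hecke_form T_mat" using hecke_form_even[of 1 1 1 0] by (simp add: T_mat_mat2)
  ultimately show ?case using incl by blast
next
  case (inv h)
  have "hecke_form (mat2 0 1 (-1) 0)" using hecke_form_odd[of 0 0 1 "-1"] by simp
  moreover have "inv\<^bsub>PSL2R\<^esub> (psl_class S_mat) = psl_class (mat2 0 1 (-1) 0)"
    by (rule psl_class_inv) (simp_all add: S_mat_mat2 det_mat2 mat2_mult mat2_one)
  moreover have "hecke_form (mat2 1 (- sqrt 2) 0 1)" using hecke_form_even[of 1 1 "-1" 0] by simp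
  moreover have "inv\<^bsub>PSL2R\<^esub> (psl_class T_mat) = psl_class (mat2 1 (- sqrt 2) 0 1)"
    by (rule psl_class_inv) (simp_all add: T_mat_mat2 det_mat2 mat2_mult mat2_one)
  ultimately show ?case using inv by blast
next
  case (eng h1 h2)
  then obtain A B where "hecke_form A" "h1 = psl_class A" "hecke_form B" "h2 = psl_class B"
    by blast
  then have "hecke_form (A ** B)" "h1 \<otimes>\<^bsub>PSL2R\<^esub> h2 = psl_class (A ** B)"
    by (simp_all add: psl_class_mult hecke_form_det hecke_form_mult)
  then show ?case by blast
qed

lemma H4_mat_iff: "M \<in> H4_mat \<longleftrightarrow> det M = 1 \<and> psl_class M \<in> H4"
proof
  assume "M \<in> H4_mat"
  then obtain X where X: "X \<in> H4" "M \<in> X" by (auto simp: H4_mat_def)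
  then obtain A where A: "hecke_form A" "X = psl_class A" using H4_hecke by blast
  have d: "det (- A) = det A" by (simp add: det_2)
  from X A have "M = A \<or> M = - A" by (simp add: psl_class_eq)
  moreover have "psl_class (- A) = psl_class A" unfolding psl_class_eq by auto
  ultimately show "det M = 1 \<and> psl_class M \<in> H4"
    using X(1) A hecke_form_det[OF A(1)] d by metis
next
  assume "det M = 1 \<and> psl_class M \<in> H4"
  then show "M \<in> H4_mat" unfolding H4_mat_def using psl_class_eq by blast
qed

lemma hecke_form_uminus: "hecke_form (- M)" if "hecke_form M"
proof -
  have "hecke_form (mat2 (-1) 0 0 (-1))" using hecke_form_even[of "-1" "-1" 0 0] by simp
  moreover have "mat2 (-1) 0 0 (-1) = - mat 1" by (simp add: mat2_one mat2_uminus)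
  ultimately have "hecke_form (- mat 1 ** M)" using hecke_form_mult that by simp
  then show ?thesis by (simp add: neg_mat_1_mult)
qed

lemma H4_mat_hecke: "M \<in> H4_mat \<Longrightarrow> hecke_form M"
proof -
  assume "M \<in> H4_mat"
  then have "psl_class M \<in> H4" by (simp add: H4_mat_iff)
  then obtain A where "hecke_form A" "psl_class M = psl_class A" using H4_hecke by blast
  then show "hecke_form M" using hecke_form_uminus[of A] by (auto simp: psl_class_eq doubleton_eq_iff)
qed

lemma H4_mat_det: "M \<in> H4_mat \<Longrightarrow> det M = 1"
  by (simp add: H4_mat_iff)

lemma H4_mat_mult: "M \<in> H4_mat \<Longrightarrow> N \<in> H4_mat \<Longrightarrow> M ** N \<in> H4_mat"
  using subgroup.m_closed[OF subgroup_H4, of "psl_class M" "psl_class N"]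
  by (simp add: H4_mat_iff psl_class_mult det_mul)

lemma H4_mat_one: "mat 1 \<in> H4_mat"
  using subgroup.one_closed[OF subgroup_H4] by (simp add: H4_mat_iff psl_class_one)

lemma H4_mat_uminus: "M \<in> H4_mat \<Longrightarrow> - M \<in> H4_mat"
proof -
  have "psl_class (- M) = psl_class M" unfolding psl_class_eq by auto
  then show "M \<in> H4_mat \<Longrightarrow> - M \<in> H4_mat" by (simp add: H4_mat_iff det_2)
qed

lemma H4_mat_S: "S_mat \<in> H4_mat" and H4_mat_T: "T_mat \<in> H4_mat"
  by (auto simp: H4_mat_iff H4_def S_mat_mat2 T_mat_mat2 det_mat2 intro!: generate.incl)

lemma H4_mat_inv:
  assumes "mat2 a b c d \<in> H4_mat"
  shows "mat2 d (- b) (- c) a \<in> H4_mat"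
proof -
  have d: "a * d - b * c = 1" using H4_mat_det[OF assms] by (simp add: det_mat2)
  then have "inv\<^bsub>PSL2R\<^esub> (psl_class (mat2 a b c d)) = psl_class (mat2 d (- b) (- c) a)"
    by (intro psl_class_inv) (simp_all add: det_mat2 mat2_mult mat2_one algebra_simps)
  then show ?thesis
    using assms subgroup.m_inv_closed[OF subgroup_H4, of "psl_class (mat2 a b c d)"] d
    by (simp add: H4_mat_iff det_mat2 mult.commute)
qed

lemma H4_mat_translation: "mat2 1 (of_int k * sqrt 2) 0 1 \<in> H4_mat"
proof (induction k rule: int_induct[where k = 0])
  case base
  then show ?case using H4_mat_one by (simp add: mat2_one)
next
  case (step1 i)
  then have "mat2 1 (of_int i * sqrt 2) 0 1 ** mat2 1 (sqrt 2) 0 1 \<in> H4_mat"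
    using H4_mat_mult H4_mat_T by (simp add: T_mat_mat2)
  then show ?case by (simp add: mat2_mult algebra_simps)
next
  case (step2 i)
  have "mat2 1 (- sqrt 2) 0 1 \<in> H4_mat"
    using H4_mat_inv H4_mat_T[unfolded T_mat_mat2] by fastforce
  then have "mat2 1 (of_int i * sqrt 2) 0 1 ** mat2 1 (- sqrt 2) 0 1 \<in> H4_mat"
    using H4_mat_mult step2 by blast
  then show ?case by (simp add: mat2_mult algebra_simps)
qed

lemma mat2_cases: obtains a b c d where "M = mat2 a b c d"
proof
  show "M = mat2 (M$1$1) (M$1$2) (M$2$1) (M$2$2)" by (simp add: mat2_eq_iff)
qed

text \<open>Discreteness of the group, in the form in which it is used: the square of \<open>sqrt 2\<close> being an
  integer makes both kinds of lower left entry either zero or bounded away from zero, and a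
  zero entry leaves a unit in the upper left corner.\<close>

lemma hecke_lower_left:
  assumes "hecke_form M"
  shows "M$2$1 = 0 \<and> \<bar>M$1$1\<bar> = 1 \<or> \<bar>M$2$1\<bar> \<ge> 1"
proof -
  have big: "\<bar>of_int c :: real\<bar> \<ge> 1" if "c \<noteq> 0" for c :: int using that by linarith
  obtain a b c d :: int where
    "(M = mat2 a (b * sqrt 2) (c * sqrt 2) d \<and> a * d - 2 * (b * c) = (1::int)) \<or>
     (M = mat2 (a * sqrt 2) b c (d * sqrt 2) \<and> 2 * (a * d) - b * c = 1)"
    using assms unfolding hecke_form_def by blast
  then show ?thesis
  proof (elim disjE conjE)
    assume h: "M = mat2 a (b * sqrt 2) (c * sqrt 2) d" "a * d - 2 * (b * c) = 1"
    show ?thesis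
    proof (cases "c = 0")
      case True
      then have "a * d = 1" using h by simp
      then have "\<bar>a\<bar> = 1" using zmult_eq_1_iff by fastforce
      then show ?thesis using True h by auto
    next
      case False
      have "1 * 1 \<le> \<bar>of_int c :: real\<bar> * sqrt 2"
        using big[OF False] by (intro mult_mono) auto
      then show ?thesis using h by (simp add: abs_mult)
    qed
  next
    assume h: "M = mat2 (a * sqrt 2) b c (d * sqrt 2)" "2 * (a * d) - b * c = 1"
    then have "c \<noteq> 0" by (auto, presburger)
    then show ?thesis using big h by auto
  qed
qed

text \<open>The determinant \<open>D\<close> of two first columns is the lower left entry of the inverse of \<open>M\<close> times \<open>N\<close>, so
  discreteness applies. This replaces coprimality of numerator and denominator, and the gap
  1 is what makes good approximations repel each other.\<close>

lemma H4_first_columns: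
  assumes "M \<in> H4_mat" "N \<in> H4_mat"
  defines "D \<equiv> M$1$1 * N$2$1 - M$2$1 * N$1$1"
  shows "\<bar>D\<bar> \<ge> 1 \<or> N$1$1 = M$1$1 \<and> N$2$1 = M$2$1 \<or> N$1$1 = - M$1$1 \<and> N$2$1 = - M$2$1"
proof -
  obtain a b c d where M: "M = mat2 a b c d" by (rule mat2_cases)
  obtain p r q s where N: "N = mat2 p r q s" by (rule mat2_cases)
  have det: "a * d - b * c = 1" using H4_mat_det[OF assms(1)] by (simp add: M det_mat2)
  have "mat2 d (- b) (- c) a ** N \<in> H4_mat"
    using H4_mat_mult H4_mat_inv assms(1,2) M by blast
  from hecke_lower_left[OF H4_mat_hecke[OF this]]
  have "(a * q - c * p = 0 \<and> \<bar>d * p - b * q\<bar> = 1) \<or> \<bar>a * q - c * p\<bar> \<ge> 1"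
    by (simp add: N mat2_mult algebra_simps)
  moreover have "p = a * (d * p - b * q) + b * (a * q - c * p)"
     "q = c * (d * p - b * q) + d * (a * q - c * p)"
    using det by algebra+
  moreover have "d * p - b * q = 1 \<or> d * p - b * q = - 1" if "\<bar>d * p - b * q\<bar> = 1"
    using that by linarith
  ultimately show ?thesis unfolding D_def M N mat2_entries
    by (metis add.right_neutral mult.right_neutral mult_minus1_right mult_zero_right)
qed

section \<open>Lagrange values are Markoff values\<close>

text \<open>Passing from the approximation inequality to the form \<open>\<bar>q\<bar> * \<bar>p - q * \<xi>\<bar>\<close>, which is
  insensitive to the sign of \<open>(p, q)\<close>.\<close>

lemma good_point_iff:
  assumes "q \<noteq> 0" "L > 0"
  shows "\<bar>\<xi> - p / q\<bar> < 1 / (L * q\<^sup>2) \<longleftrightarrow> \<bar>q\<bar> * \<bar>p - q * \<xi>\<bar> < 1 / (L::real)"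
proof -
  have "\<xi> - p / q = - (p - q * \<xi>) / q" using assms by (simp add: field_simps)
  then have 1: "\<bar>\<xi> - p / q\<bar> = \<bar>p - q * \<xi>\<bar> / \<bar>q\<bar>" by (simp add: abs_divide abs_minus_commute)
  have 2: "1 / (L * q\<^sup>2) = (1 / L) / \<bar>q\<bar> / \<bar>q\<bar>" by (simp add: power2_eq_square)
  have *: "x / y < u / y / y \<longleftrightarrow> y * x < u" if "y > 0" for x y u :: real
    using that by (simp add: field_simps)
  show ?thesis unfolding 1 2 by (rule *) (use assms in simp)
qed

lemma good_pointsE:
  assumes "x \<in> good_points \<xi> L" "L > 0"
  obtains M where "M \<in> H4_mat" "M$2$1 \<noteq> 0" "x = moebius M Infty" "\<bar>M$2$1\<bar> * \<bar>M$1$1 - M$2$1 * \<xi>\<bar> < 1 / L"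
proof -
  from assms(1) obtain M where M: "M \<in> H4_mat" "M$2$1 \<noteq> 0" "x = moebius M Infty"
    "\<bar>\<xi> - M$1$1 / M$2$1\<bar> < 1 / (L * (M$2$1)\<^sup>2)" by (auto simp: good_points_def)
  then show ?thesis using that good_point_iff[OF M(2) assms(2)] by blast
qed

lemma good_pointsI:
  assumes "M \<in> H4_mat" "M$2$1 \<noteq> 0" "\<bar>M$2$1\<bar> * \<bar>M$1$1 - M$2$1 * \<xi>\<bar> < 1 / L" "L > 0"
  shows "moebius M Infty \<in> good_points \<xi> L"
  using assms good_point_iff[OF assms(2,4)] unfolding good_points_def by blast

lemma hecke_first_column:
  assumes "M \<in> H4_mat"
  obtains (even) a c :: int where "M$1$1 = of_int a" "M$2$1 = of_int c * sqrt 2"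
    | (odd) a c :: int where "M$1$1 = of_int a * sqrt 2" "M$2$1 = of_int c"
  using H4_mat_hecke[OF assms] unfolding hecke_form_def by auto

lemma cusp_sqrt2_rational:
  assumes "M \<in> H4_mat"
  shows "M$1$1 / M$2$1 \<in> sqrt2_rationals"
  using assms
proof (cases rule: hecke_first_column)
  case (even a c)
  then have "M$1$1 / M$2$1 = sqrt 2 * (of_int a / (2 * of_int c))"
    by (cases "c = 0") (simp_all add: field_simps)
  moreover have "of_int a / (2 * of_int c) \<in> (\<rat> :: real set)" by simp
  ultimately show ?thesis unfolding sqrt2_rationals_def by (rule image_eqI)
next
  case (odd a c)
  then have "M$1$1 / M$2$1 = sqrt 2 * (of_int a / of_int c)" by simp
  moreover have "of_int a / of_int c \<in> (\<rat> :: real set)" by simp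
  ultimately show ?thesis unfolding sqrt2_rationals_def by (rule image_eqI)
qed

lemma same_cusp_same_form:
  assumes "M \<in> H4_mat" "N \<in> H4_mat" "M$2$1 \<noteq> 0" "N$2$1 \<noteq> 0" "moebius M Infty = moebius N Infty"
  shows "\<bar>M$1$1 - M$2$1 * \<xi>\<bar> = \<bar>N$1$1 - N$2$1 * \<xi>\<bar>"
proof -
  have "M$1$1 / M$2$1 = N$1$1 / N$2$1" using assms by simp
  then have "M$1$1 * N$2$1 - M$2$1 * N$1$1 = 0" using assms by (simp add: field_simps)
  then show ?thesis using H4_first_columns[OF assms(1,2)] by (auto simp: abs_minus_commute)
qed

text \<open>A bound on the denominator and on the form bounds both integers that determine the cusp.\<close>

lemma finite_low_cusps:
  assumes "L > 0"
  shows "finite {moebius M Infty |M. M \<in> H4_mat \<and> M$2$1 \<noteq> 0 \<and> \<bar>M$2$1\<bar> \<le> B \<and>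
    \<bar>M$2$1\<bar> * \<bar>M$1$1 - M$2$1 * \<xi>\<bar> < 1 / L}" (is "finite ?S")
proof -
  define K where "K = \<lceil>\<bar>B\<bar> + \<bar>B\<bar> * \<bar>\<xi>\<bar> + 1 / L\<rceil>"
  define I where "I = {- K..K}"
  have I: "i \<in> I" if "\<bar>of_int i\<bar> \<le> \<bar>B\<bar> + \<bar>B\<bar> * \<bar>\<xi>\<bar> + 1 / L" for i :: int
  proof -
    have "of_int \<bar>i\<bar> \<le> (of_int K :: real)" unfolding K_def using that by simp linarith
    then show ?thesis unfolding I_def by (simp only: of_int_le_iff) auto
  qed
  have "?S \<subseteq> (\<lambda>(a, c). Fin (of_int a / (of_int c * sqrt 2))) ` (I \<times> I) \<union>
     (\<lambda>(a, c). Fin (of_int a * sqrt 2 / of_int c)) ` (I \<times> I)"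
  proof
    fix x assume "x \<in> ?S"
    then obtain M where M: "x = moebius M Infty" "M \<in> H4_mat" "M$2$1 \<noteq> 0" "\<bar>M$2$1\<bar> \<le> B"
      "\<bar>M$2$1\<bar> * \<bar>M$1$1 - M$2$1 * \<xi>\<bar> < 1 / L" by blast
    have q: "1 \<le> \<bar>M$2$1\<bar>" using hecke_lower_left[OF H4_mat_hecke[OF M(2)]] M(3) by auto
    have "1 * \<bar>M$1$1 - M$2$1 * \<xi>\<bar> \<le> \<bar>M$2$1\<bar> * \<bar>M$1$1 - M$2$1 * \<xi>\<bar>"
      using q by (intro mult_right_mono) auto
    then have "\<bar>M$1$1 - M$2$1 * \<xi>\<bar> \<le> 1 / L" using M(5) by simp
    moreover have "\<bar>M$2$1 * \<xi>\<bar> \<le> \<bar>B\<bar> * \<bar>\<xi>\<bar>" unfolding abs_mult using M(4) by (intro mult_right_mono) auto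
    ultimately have p: "\<bar>M$1$1\<bar> \<le> \<bar>B\<bar> * \<bar>\<xi>\<bar> + 1 / L" by linarith
    have s: "\<bar>of_int i\<bar> \<le> \<bar>of_int i * sqrt 2\<bar>" for i :: int
      using mult_left_mono[of 1 "sqrt 2" "\<bar>of_int i\<bar>"] by (simp add: abs_mult)
    have nn: "0 \<le> \<bar>B\<bar> * \<bar>\<xi>\<bar>" "0 < 1 / L" using assms by auto
    from M(2) show "x \<in> (\<lambda>(a, c). Fin (of_int a / (of_int c * sqrt 2))) ` (I \<times> I) \<union>
     (\<lambda>(a, c). Fin (of_int a * sqrt 2 / of_int c)) ` (I \<times> I)"
    proof (cases rule: hecke_first_column)
      case (even a c)
      have "a \<in> I" "c \<in> I"
        using p M(4) nn s[of c] unfolding even by (intro I; linarith)+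
      then show ?thesis using M(1,3) even by force
    next
      case (odd a c)
      have "a \<in> I" "c \<in> I"
        using p M(4) nn s[of a] unfolding odd by (intro I; linarith)+
      then show ?thesis using M(1,3) odd by force
    qed
  qed
  then show ?thesis by (rule finite_subset) (simp add: I_def)
qed

lemma matrix_mult_first_column:
  fixes M N :: "real^2^2"
  shows "(M ** N)$1$1 = M$1$1 * N$1$1 + M$1$2 * N$2$1" "(M ** N)$2$1 = M$2$1 * N$1$1 + M$2$2 * N$2$1"
  by (simp_all add: matrix_matrix_mult_def sum_2)

text \<open>A supremum over the empty set is \<open>- \<infinity>\<close>, so a real Lagrange value is automatically positive.\<close>

lemma Lagrange_value_finite:
  assumes "Lagrange_value \<xi> = ereal l"
  shows "0 < l" "\<And>L. l < L \<Longrightarrow> finite (good_points \<xi> L)"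
    "\<And>L. 0 < L \<Longrightarrow> L < l \<Longrightarrow> infinite (good_points \<xi> L)"
proof -
  define A where "A = {ereal L |L. L > 0 \<and> infinite (good_points \<xi> L)}"
  have S: "Sup A = ereal l" using assms by (simp add: Lagrange_value_def A_def)
  have "A \<noteq> {}"
  proof
    assume "A = {}"
    then show False using S by (simp add: bot_ereal_def)
  qed
  then obtain L where L: "L > 0" "ereal L \<in> A" by (auto simp: A_def)
  then have "ereal L \<le> ereal l" using S by (metis Sup_upper)
  then show l: "0 < l" using L by simp
  show "finite (good_points \<xi> L)" if "l < L" for L
  proof (rule ccontr)
    assume "infinite (good_points \<xi> L)"
    then have "ereal L \<in> A" using that l by (auto simp: A_def)
    then have "ereal L \<le> ereal l" using S by (metis Sup_upper)
    then show False using that by simp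
  qed
  show "infinite (good_points \<xi> L)" if L: "0 < L" "L < l" for L
  proof -
    have "ereal L < Sup A" using L S by simp
    then obtain L' where L': "L < L'" "infinite (good_points \<xi> L')" by (auto simp: less_Sup_iff A_def)
    have "good_points \<xi> L' \<subseteq> good_points \<xi> L"
    proof
      fix x assume "x \<in> good_points \<xi> L'"
      then obtain M where M: "M \<in> H4_mat" "M$2$1 \<noteq> 0" "x = moebius M Infty"
        "\<bar>M$2$1\<bar> * \<bar>M$1$1 - M$2$1 * \<xi>\<bar> < 1 / L'" using L L' by (elim good_pointsE) auto
      have "1 / L' \<le> 1 / L" using L L' by (intro divide_left_mono) auto
      then show "x \<in> good_points \<xi> L" unfolding M(3) using M L by (intro good_pointsI) auto
    qed
    then show ?thesis using L'(2) infinite_super by blast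
  qed
qed

text \<open>Between the levels just below and just above \<open>l\<close> there are infinitely many cusps, hence some with
  large denominator. Replacing \<open>M\<close> by \<open>M\<close> times a translation keeps the cusp and moves \<open>- s / q\<close>,
  the image of \<open>\<infinity>\<close> under the inverse of \<open>M\<close>, by multiples of \<open>sqrt 2\<close>; this places it in a
  compact interval.\<close>

lemma extremal_sequence:
  assumes "Lagrange_value \<xi> = ereal l"
  shows "\<exists>M. M \<in> H4_mat \<and> real n \<le> \<bar>M$2$1\<bar> \<and> M$2$1 \<noteq> 0 \<and>
    1 / (l + 1 / (real n + 1)) \<le> \<bar>M$2$1\<bar> * \<bar>M$1$1 - M$2$1 * \<xi>\<bar> \<and>
    \<bar>M$2$1\<bar> * \<bar>M$1$1 - M$2$1 * \<xi>\<bar> \<le> 1 / (l - l / (real n + 2)) \<and>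
    0 \<le> - M$2$2 / M$2$1 \<and> - M$2$2 / M$2$1 \<le> sqrt 2"
proof -
  note F = Lagrange_value_finite[OF assms]
  define L1 L2 where "L1 = l - l / (real n + 2)" "L2 = l + 1 / (real n + 1)"
  have L1: "0 < L1" "L1 < l" and L2: "l < L2" "0 < L2"
    using F(1) by (auto simp: L1_L2_def field_simps add_pos_nonneg)
  define S where "S = {moebius M Infty |M. M \<in> H4_mat \<and> M$2$1 \<noteq> 0 \<and> \<bar>M$2$1\<bar> \<le> real n \<and>
    \<bar>M$2$1\<bar> * \<bar>M$1$1 - M$2$1 * \<xi>\<bar> < 1 / L1}"
  have "finite (S \<union> good_points \<xi> L2)" using finite_low_cusps[OF L1(1)] F(2)[OF L2(1)] by (simp add: S_def)
  then have "infinite (good_points \<xi> L1 - (S \<union> good_points \<xi> L2))"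
    using F(3)[OF L1] by (rule Diff_infinite_finite)
  then obtain x where x: "x \<in> good_points \<xi> L1" "x \<notin> S" "x \<notin> good_points \<xi> L2"
    by (metis Diff_iff Un_iff finite.emptyI equals0I)
  obtain M where M: "M \<in> H4_mat" "M$2$1 \<noteq> 0" "x = moebius M Infty"
     "\<bar>M$2$1\<bar> * \<bar>M$1$1 - M$2$1 * \<xi>\<bar> < 1 / L1" by (rule good_pointsE[OF x(1) L1(1)])
  have big: "real n \<le> \<bar>M$2$1\<bar>" using x(2) M unfolding S_def by force
  have low: "1 / L2 \<le> \<bar>M$2$1\<bar> * \<bar>M$1$1 - M$2$1 * \<xi>\<bar>"
    using x(3) M good_pointsI[OF M(1,2) _ L2(2)] by force
  obtain p r q s where e: "M = mat2 p r q s" by (rule mat2_cases)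
  define k where "k = \<lfloor>- s / (q * sqrt 2)\<rfloor>"
  define M' where "M' = M ** mat2 1 (of_int k * sqrt 2) 0 1"
  have M': "M' \<in> H4_mat" unfolding M'_def by (intro H4_mat_mult M H4_mat_translation)
  have e': "M' = mat2 p (p * (of_int k * sqrt 2) + r) q (q * (of_int k * sqrt 2) + s)"
    by (simp add: M'_def e mat2_mult)
  have q: "q \<noteq> 0" using M(2) e by simp
  have k: "of_int k \<le> - s / (q * sqrt 2)" "- s / (q * sqrt 2) \<le> of_int k + 1"
    unfolding k_def by linarith+
  have "- M'$2$2 / M'$2$1 = (- s / (q * sqrt 2) - of_int k) * sqrt 2"
    using q by (simp add: e' field_simps)
  moreover have "0 \<le> (- s / (q * sqrt 2) - of_int k) * sqrt 2" using k by (intro mult_nonneg_nonneg) auto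
  moreover have "(- s / (q * sqrt 2) - of_int k) * sqrt 2 \<le> 1 * sqrt 2" using k by (intro mult_right_mono) auto
  ultimately show ?thesis
    using M' big low M(2,4) unfolding L1_L2_def by (intro exI[of _ M']) (auto simp: e e')
qed

text \<open>The notation follows the pair \<open>(\<zeta> n, \<eta> n)\<close>, the images of \<open>\<xi>\<close> and \<open>\<infinity>\<close> under the inverse of
  \<open>M n\<close>, whose difference is the reciprocal of \<open>v n = q n * \<delta> n\<close>. A subsequence converges to
  \<open>(X, H)\<close>. For \<open>A\<close> with first column \<open>(a, c)\<close> the inverse of \<open>A\<close> divides the difference \<open>X - H\<close> by
  \<open>(a - c * X) * (a - c * H)\<close>, so the claim is that this product is at least 1 in absolute value;
  this also excludes that the image of \<open>X\<close> or \<open>H\<close> is \<open>\<infinity>\<close>.\<close>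

lemma Lagrange_subset_Markoff: "Lagrange_spectrum \<subseteq> Markoff_spectrum"
proof
  fix l assume "l \<in> Lagrange_spectrum"
  then obtain \<xi> where irr: "\<xi> \<notin> sqrt2_rationals" and val: "Lagrange_value \<xi> = ereal l"
    by (auto simp: Lagrange_spectrum_def)
  note F = Lagrange_value_finite[OF val]
  have l: "0 < l" by (rule F(1))
  have "\<forall>n. \<exists>M. M \<in> H4_mat \<and> real n \<le> \<bar>M$2$1\<bar> \<and> M$2$1 \<noteq> 0 \<and>
    1 / (l + 1 / (real n + 1)) \<le> \<bar>M$2$1\<bar> * \<bar>M$1$1 - M$2$1 * \<xi>\<bar> \<and>
    \<bar>M$2$1\<bar> * \<bar>M$1$1 - M$2$1 * \<xi>\<bar> \<le> 1 / (l - l / (real n + 2)) \<and>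
    0 \<le> - M$2$2 / M$2$1 \<and> - M$2$2 / M$2$1 \<le> sqrt 2"
    using extremal_sequence[OF val] by blast
  from choice[OF this] obtain M where M0: "\<forall>n. M n \<in> H4_mat \<and> real n \<le> \<bar>M n$2$1\<bar> \<and> M n$2$1 \<noteq> 0 \<and>
    1 / (l + 1 / (real n + 1)) \<le> \<bar>M n$2$1\<bar> * \<bar>M n$1$1 - M n$2$1 * \<xi>\<bar> \<and>
    \<bar>M n$2$1\<bar> * \<bar>M n$1$1 - M n$2$1 * \<xi>\<bar> \<le> 1 / (l - l / (real n + 2)) \<and>
    0 \<le> - M n$2$2 / M n$2$1 \<and> - M n$2$2 / M n$2$1 \<le> sqrt 2" ..
  define q where "q n = M n$2$1" for n
  define \<delta> where "\<delta> n = M n$1$1 - q n * \<xi>" for n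
  define \<eta> where "\<eta> n = - M n$2$2 / q n" for n
  define v where "v n = q n * \<delta> n" for n
  define \<zeta> where "\<zeta> n = \<eta> n + 1 / v n" for n
  have M: "M n \<in> H4_mat" "real n \<le> \<bar>q n\<bar>" "q n \<noteq> 0" "1 / (l + 1 / (real n + 1)) \<le> \<bar>v n\<bar>"
    "\<bar>v n\<bar> \<le> 1 / (l - l / (real n + 2))" "0 \<le> \<eta> n" "\<eta> n \<le> sqrt 2" for n
    using M0[rule_format, of n] by (auto simp: q_def \<delta>_def \<eta>_def v_def abs_mult)
  have v_pos: "0 < \<bar>v n\<bar>" for n
  proof -
    have "0 < 1 / (l + 1 / (real n + 1))" using l by (simp add: add_pos_nonneg)
    then show ?thesis using M(4)[of n] by linarith
  qed
  have v_lim: "(\<lambda>n. \<bar>v n\<bar>) \<longlonglongrightarrow> 1 / l"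
  proof (rule tendsto_sandwich)
    have "(\<lambda>n. 1 / (real n + 1)) \<longlonglongrightarrow> 0"
      using LIMSEQ_ignore_initial_segment[OF lim_const_over_n[of 1], of 1] by (simp add: add.commute)
    then have "(\<lambda>n. 1 / (l + 1 / (real n + 1))) \<longlonglongrightarrow> 1 / (l + 0)"
      using l by (intro tendsto_intros) auto
    then show "(\<lambda>n. 1 / (l + 1 / (real n + 1))) \<longlonglongrightarrow> 1 / l" by simp
    have "(\<lambda>n. l / (real n + 2)) \<longlonglongrightarrow> 0"
      using LIMSEQ_ignore_initial_segment[OF lim_const_over_n[of l], of 2] by (simp add: add.commute)
    then have "(\<lambda>n. 1 / (l - l / (real n + 2))) \<longlonglongrightarrow> 1 / (l - 0)"
      using l by (intro tendsto_intros) auto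
    then show "(\<lambda>n. 1 / (l - l / (real n + 2))) \<longlonglongrightarrow> 1 / l" by simp
  qed (use M in auto)
  have inv_lim: "(\<lambda>n. 1 / \<bar>v n\<bar>) \<longlonglongrightarrow> l"
    using tendsto_divide[OF tendsto_const v_lim, of 1] l by simp
  have \<delta>_lim: "\<delta> \<longlonglongrightarrow> 0"
  proof -
    have "(\<lambda>n. \<bar>v n\<bar> * (1 / real n)) \<longlonglongrightarrow> 1 / l * 0"
      by (intro tendsto_mult v_lim lim_1_over_n)
    moreover have "eventually (\<lambda>n. norm (\<delta> n) \<le> \<bar>v n\<bar> * (1 / real n)) sequentially"
      using eventually_gt_at_top[of 0]
    proof eventually_elim
      case (elim n)
      have "\<bar>\<delta> n\<bar> * real n \<le> \<bar>\<delta> n\<bar> * \<bar>q n\<bar>" using M(2)[of n] by (intro mult_left_mono) auto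
      then show ?case using elim by (simp add: v_def abs_mult field_simps)
    qed
    ultimately show ?thesis
      using Lim_null_comparison[of \<delta> "\<lambda>n. \<bar>v n\<bar> * (1 / real n)" sequentially] by simp
  qed
  have "bounded (range (\<lambda>n. (\<zeta> n, \<eta> n)))"
  proof -
    have "bounded (range (\<lambda>n. 1 / \<bar>v n\<bar>))" using inv_lim convergent_imp_bounded by blast
    then obtain B where B: "\<And>n. 1 / \<bar>v n\<bar> \<le> B" unfolding bounded_iff by (auto simp: abs_le_iff)
    have "(\<zeta> n, \<eta> n) \<in> cbox (- B, 0) (sqrt 2 + B, sqrt 2)" for n
    proof -
      have "\<bar>1 / v n\<bar> \<le> B" using B[of n] by simp
      then have "- B \<le> \<zeta> n" "\<zeta> n \<le> sqrt 2 + B"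
        using M(6,7)[of n] unfolding \<zeta>_def abs_le_iff by linarith+
      then show ?thesis using M(6,7)[of n] by (simp add: cbox_Pair_eq)
    qed
    then have "range (\<lambda>n. (\<zeta> n, \<eta> n)) \<subseteq> cbox (- B, 0) (sqrt 2 + B, sqrt 2)" by blast
    then show ?thesis using bounded_cbox bounded_subset by blast
  qed
  from bounded_imp_convergent_subsequence[OF this] obtain XH \<rho> where
    \<rho>: "strict_mono (\<rho> :: nat \<Rightarrow> nat)" "((\<lambda>n. (\<zeta> n, \<eta> n)) \<circ> \<rho>) \<longlonglongrightarrow> XH" by blast
  obtain X H where XH: "XH = (X, H)" by fastforce
  have X: "(\<lambda>n. \<zeta> (\<rho> n)) \<longlonglongrightarrow> X" and H: "(\<lambda>n. \<eta> (\<rho> n)) \<longlonglongrightarrow> H"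
    using tendsto_fst[OF \<rho>(2)] tendsto_snd[OF \<rho>(2)] by (simp_all add: XH o_def)
  have sub: "(\<lambda>n. f (\<rho> n)) \<longlonglongrightarrow> c" if "f \<longlonglongrightarrow> c" for f and c :: real
    using LIMSEQ_subseq_LIMSEQ[OF that \<rho>(1)] by (simp add: o_def)
  have XHl: "\<bar>X - H\<bar> = l"
  proof (rule LIMSEQ_unique)
    show "(\<lambda>n. \<bar>\<zeta> (\<rho> n) - \<eta> (\<rho> n)\<bar>) \<longlonglongrightarrow> \<bar>X - H\<bar>" by (intro tendsto_intros X H)
    show "(\<lambda>n. \<bar>\<zeta> (\<rho> n) - \<eta> (\<rho> n)\<bar>) \<longlonglongrightarrow> l" using sub[OF inv_lim] by (simp add: \<zeta>_def)
  qed
  have key: "1 \<le> \<bar>(A$1$1 - A$2$1 * X) * (A$1$1 - A$2$1 * H)\<bar>" if A: "A \<in> H4_mat" for A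
  proof (rule ccontr)
    define a c where "a = A$1$1" "c = A$2$1"
    define w where "w = \<bar>(a - c * X) * (a - c * H)\<bar>"
    assume "\<not> ?thesis"
    then have w: "0 \<le> w" "w < 1" by (auto simp: w_def a_c_def)
    \<comment> \<open>any \<open>L > l\<close> with \<open>w / l < 1 / L\<close> would do\<close>
    define L where "L = 2 * l / (1 + w)"
    have L: "l < L" "w / l < 1 / L" "0 < L" using w l by (auto simp: L_def field_simps)
    define N where "N n = M (\<rho> n) ** A" for n
    have N: "N n \<in> H4_mat" for n unfolding N_def by (intro H4_mat_mult M A)
    have q': "N n$2$1 = q (\<rho> n) * (a - c * \<eta> (\<rho> n))" for n
      using M(3)[of "\<rho> n"] unfolding N_def matrix_mult_first_column \<eta>_def a_c_def
      by (simp add: q_def field_simps)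
    have \<delta>': "N n$1$1 - N n$2$1 * \<xi> = \<delta> (\<rho> n) * (a - c * \<zeta> (\<rho> n))" for n
    proof -
      obtain p r q' s where m: "M (\<rho> n) = mat2 p r q' s" by (rule mat2_cases)
      have det: "p * s - r * q' = 1" using H4_mat_det[OF M(1)[of "\<rho> n"]] by (simp add: m det_mat2)
      have q: "q (\<rho> n) = q'" "q' \<noteq> 0" using M(3)[of "\<rho> n"] by (simp_all add: q_def m)
      have d: "\<delta> (\<rho> n) = p - q' * \<xi>" by (simp add: \<delta>_def q m)
      have d0: "p - q' * \<xi> \<noteq> 0" using v_pos[of "\<rho> n"] by (auto simp: v_def d)
      have "\<zeta> (\<rho> n) = - s / q' + 1 / (q' * (p - q' * \<xi>))" by (simp add: \<zeta>_def \<eta>_def v_def d q m)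
      also have "\<dots> = (1 - s * (p - q' * \<xi>)) / (q' * (p - q' * \<xi>))"
        using d0 q by (simp add: field_simps)
      also have "1 - s * (p - q' * \<xi>) = q' * (s * \<xi> - r)" using det by algebra
      finally have z: "\<zeta> (\<rho> n) = (s * \<xi> - r) / (p - q' * \<xi>)" using q by simp
      have "\<delta> (\<rho> n) * (a - c * \<zeta> (\<rho> n)) = a * (p - q' * \<xi>) - c * (s * \<xi> - r)"
      proof -
        have "D * (a - c * (x / D)) = a * D - c * x" if "D \<noteq> 0" for D x
          using that by (simp add: right_diff_distrib)
        then show ?thesis unfolding d z using d0 by blast
      qed
      also have "\<dots> = (p * a + r * c) - (q' * a + s * c) * \<xi>" by (simp add: algebra_simps)
      finally show ?thesis by (simp add: N_def matrix_mult_first_column m a_c_def)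
    qed
    have lim0: "(\<lambda>n. \<delta> (\<rho> n) * (a - c * \<zeta> (\<rho> n))) \<longlonglongrightarrow> 0 * (a - c * X)"
      by (intro tendsto_intros sub[OF \<delta>_lim] X)
    have lim1: "(\<lambda>n. \<bar>v (\<rho> n)\<bar> * \<bar>(a - c * \<zeta> (\<rho> n)) * (a - c * \<eta> (\<rho> n))\<bar>) \<longlonglongrightarrow> 1 / l * w"
      unfolding w_def by (intro tendsto_intros sub[OF v_lim] X H)
    have fin: "finite (good_points \<xi> L)" by (rule F(2)[OF L(1)])
    define g where "g x = (SOME y. \<exists>B\<in>H4_mat. B$2$1 \<noteq> 0 \<and> moebius B Infty = x \<and> y = \<bar>B$1$1 - B$2$1 * \<xi>\<bar>)" for x
    have g: "g (moebius B Infty) = \<bar>B$1$1 - B$2$1 * \<xi>\<bar>" if B: "B \<in> H4_mat" "B$2$1 \<noteq> 0" for B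
    proof -
      have "\<exists>y. \<exists>B'\<in>H4_mat. B'$2$1 \<noteq> 0 \<and> moebius B' Infty = moebius B Infty \<and> y = \<bar>B'$1$1 - B'$2$1 * \<xi>\<bar>"
        using B by blast
      from someI_ex[OF this] obtain B' where "B' \<in> H4_mat" "B'$2$1 \<noteq> 0"
        "moebius B' Infty = moebius B Infty" "g (moebius B Infty) = \<bar>B'$1$1 - B'$2$1 * \<xi>\<bar>"
        unfolding g_def by blast
      then show ?thesis using same_cusp_same_form B by metis
    qed
    \<comment> \<open>the positive errors of the finitely many counted cusps; the element 1 also keeps \<open>N n\<close> from fixing \<open>\<infinity>\<close>\<close>
    define E where "E = insert 1 {y \<in> g ` good_points \<xi> L. 0 < y}"
    have E: "finite E" "E \<noteq> {}" using fin by (auto simp: E_def)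
    then have "Min E \<in> E" by (rule Min_in)
    then have E0: "0 < Min E" "Min E \<le> 1" using E by (auto simp: E_def)
    have "eventually (\<lambda>n. \<bar>\<delta> (\<rho> n) * (a - c * \<zeta> (\<rho> n))\<bar> < Min E) sequentially"
      using tendsto_rabs[OF lim0] E0 by (intro order_tendstoD(2)) auto
    moreover have "eventually (\<lambda>n. \<bar>v (\<rho> n)\<bar> * \<bar>(a - c * \<zeta> (\<rho> n)) * (a - c * \<eta> (\<rho> n))\<bar> < 1 / L) sequentially"
      using L by (intro order_tendstoD(2)[OF lim1]) simp
    ultimately have "eventually (\<lambda>n. \<bar>\<delta> (\<rho> n) * (a - c * \<zeta> (\<rho> n))\<bar> < Min E \<and>
       \<bar>v (\<rho> n)\<bar> * \<bar>(a - c * \<zeta> (\<rho> n)) * (a - c * \<eta> (\<rho> n))\<bar> < 1 / L) sequentially"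
      by (rule eventually_conj)
    then obtain n where n: "\<bar>\<delta> (\<rho> n) * (a - c * \<zeta> (\<rho> n))\<bar> < Min E"
       "\<bar>v (\<rho> n)\<bar> * \<bar>(a - c * \<zeta> (\<rho> n)) * (a - c * \<eta> (\<rho> n))\<bar> < 1 / L"
      by (auto simp: eventually_sequentially)
    have small: "\<bar>N n$1$1 - N n$2$1 * \<xi>\<bar> < Min E" using n(1) by (simp add: \<delta>')
    have Nq: "N n$2$1 \<noteq> 0"
    proof
      assume 0: "N n$2$1 = 0"
      then have "\<bar>N n$1$1\<bar> = 1" using hecke_lower_left[OF H4_mat_hecke[OF N[of n]]] by auto
      then show False using small E0 0 by simp
    qed
    have "\<bar>N n$2$1\<bar> * \<bar>N n$1$1 - N n$2$1 * \<xi>\<bar> < 1 / L"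
      using n(2) unfolding \<delta>' unfolding q' by (simp add: v_def abs_mult mult_ac)
    then have "moebius (N n) Infty \<in> good_points \<xi> L" by (intro good_pointsI N Nq L)
    moreover have "0 < \<bar>N n$1$1 - N n$2$1 * \<xi>\<bar>"
    proof -
      have "N n$1$1 - N n$2$1 * \<xi> \<noteq> 0"
      proof
        assume "N n$1$1 - N n$2$1 * \<xi> = 0"
        then have "\<xi> = N n$1$1 / N n$2$1" using Nq by (simp add: field_simps)
        then show False using irr cusp_sqrt2_rational[OF N] by simp
      qed
      then show ?thesis by simp
    qed
    ultimately have "\<bar>N n$1$1 - N n$2$1 * \<xi>\<bar> \<in> E" using g[OF N Nq] unfolding E_def by force
    then show False using small Min_le[OF E(1)] by fastforce
  qed
  have diff: "rhat_diff (moebius (matrix_inv A) (Fin X)) (moebius (matrix_inv A) (Fin H)) \<le> ereal l"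
    if A: "A \<in> H4_mat" for A
  proof -
    obtain a b c d where e: "A = mat2 a b c d" by (rule mat2_cases)
    have det: "a * d - b * c = 1" using H4_mat_det[OF A] by (simp add: e det_mat2)
    have k: "1 \<le> \<bar>(a - c * X) * (a - c * H)\<bar>" using key[OF A] by (simp add: e)
    have nz: "a - c * X \<noteq> 0" "a - c * H \<noteq> 0" using k by auto
    have nz': "- c * X + a \<noteq> 0" "- c * H + a \<noteq> 0" using nz by auto
    have "(d * X - b) / (a - c * X) - (d * H - b) / (a - c * H)
        = ((d * X - b) * (a - c * H) - (d * H - b) * (a - c * X)) / ((a - c * X) * (a - c * H))"
      using nz by (simp add: diff_frac_eq)
    also have "(d * X - b) * (a - c * H) - (d * H - b) * (a - c * X) = (a * d - b * c) * (X - H)"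
      by (simp add: algebra_simps)
    finally have "\<bar>(d * X - b) / (a - c * X) - (d * H - b) / (a - c * H)\<bar> = l / \<bar>(a - c * X) * (a - c * H)\<bar>"
      by (simp add: det XHl abs_divide)
    also have "\<dots> \<le> l / 1" using k l by (intro divide_left_mono) auto
    finally have "\<bar>(d * X - b) / (a - c * X) - (d * H - b) / (a - c * H)\<bar> \<le> l" by simp
    moreover have "moebius (matrix_inv A) (Fin X) = Fin ((d * X - b) / (a - c * X))"
      "moebius (matrix_inv A) (Fin H) = Fin ((d * H - b) / (a - c * H))"
      using nz by (simp_all add: e matrix_inv_mat2[OF det])
    ultimately show ?thesis by simp
  qed
  have "Markoff_value (Fin X) (Fin H) = ereal l"
    unfolding Markoff_value_def
  proof (rule antisym)
    show "(SUP A\<in>H4_mat. rhat_diff (moebius (matrix_inv A) (Fin X)) (moebius (matrix_inv A) (Fin H))) \<le> ereal l"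
      using diff by (rule SUP_least)
    have "rhat_diff (moebius (matrix_inv (mat 1)) (Fin X)) (moebius (matrix_inv (mat 1)) (Fin H)) = ereal l"
      using XHl matrix_inv_mat2[of 1 1 0 0] by (simp add: mat2_one)
    then show "ereal l \<le> (SUP A\<in>H4_mat. rhat_diff (moebius (matrix_inv A) (Fin X)) (moebius (matrix_inv A) (Fin H)))"
      by (metis (no_types, lifting) SUP_upper H4_mat_one)
  qed
  moreover have "Fin X \<noteq> Fin H" using XHl l by auto
  ultimately show "l \<in> Markoff_spectrum" unfolding Markoff_spectrum_def by blast
qed

section \<open>Sums of two sets built by removing gaps\<close>

text \<open>A family of intervals \<open>[lo n, hi n]\<close>, each of which is covered by two members of the family up to
  a gap of length at most \<open>gp n\<close> between them. The decisive condition is that \<open>gp n\<close> exceeds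
  neither child's length. The factors \<open>9/10\<close> and \<open>30\<close> make the intervals of a refinement
  shrink: gaps decay along every branch and control the lengths.\<close>

definition gap_tree :: "'n set \<Rightarrow> ('n \<Rightarrow> real) \<Rightarrow> ('n \<Rightarrow> real) \<Rightarrow> ('n \<Rightarrow> real) \<Rightarrow> bool" where
  "gap_tree N lo hi gp \<longleftrightarrow> (\<forall>n\<in>N. 0 < gp n \<and> hi n - lo n \<le> 30 * gp n \<and>
     (\<exists>a\<in>N. \<exists>b\<in>N. lo a \<le> lo n \<and> hi n \<le> hi b \<and> lo b - hi a \<le> gp n \<and>
        gp n \<le> hi a - lo a \<and> gp n \<le> hi b - lo b \<and>
        gp a \<le> 9/10 * gp n \<and> gp b \<le> 9/10 * gp n))"

lemma gap_treeD:
  assumes "gap_tree N lo hi gp" "n \<in> N"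
  shows "0 < gp n" "hi n - lo n \<le> 30 * gp n"
    "\<exists>a\<in>N. \<exists>b\<in>N. lo a \<le> lo n \<and> hi n \<le> hi b \<and> lo b - hi a \<le> gp n \<and>
        gp n \<le> hi a - lo a \<and> gp n \<le> hi b - lo b \<and>
        gp a \<le> 9/10 * gp n \<and> gp b \<le> 9/10 * gp n"
  using assms unfolding gap_tree_def by (force, force, blast)

text \<open>Negating all intervals turns a statement about sums into one about differences.\<close>

lemma gap_tree_reflect:
  assumes "gap_tree N lo hi gp"
  shows "gap_tree N (\<lambda>n. - hi n) (\<lambda>n. - lo n) gp"
  unfolding gap_tree_def
proof (intro ballI conjI)
  fix n assume n: "n \<in> N"
  note D = gap_treeD[OF assms n]
  show "0 < gp n" "- lo n - - hi n \<le> 30 * gp n" using D by auto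
  from D(3) obtain a b where ab: "a \<in> N" "b \<in> N" "lo a \<le> lo n" "hi n \<le> hi b" "lo b - hi a \<le> gp n"
        "gp n \<le> hi a - lo a" "gp n \<le> hi b - lo b"
        "gp a \<le> 9/10 * gp n" "gp b \<le> 9/10 * gp n" by blast
  show "\<exists>a\<in>N. \<exists>b\<in>N. - hi a \<le> - hi n \<and> - lo n \<le> - lo b \<and> - hi b - - lo a \<le> gp n \<and>
        gp n \<le> - lo a - - hi a \<and> gp n \<le> - lo b - - hi b \<and>
        gp a \<le> 9/10 * gp n \<and> gp b \<le> 9/10 * gp n"
    by (rule bexI[OF _ ab(2)], rule bexI[OF _ ab(1)]) (use ab in auto)
qed

text \<open>Each interval is long enough to bridge the gap of the other one, and \<open>s\<close> lies in their sum.\<close>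

definition interlocked where
  "interlocked lo hi gp lo' hi' gp' s I J \<longleftrightarrow>
     gp I \<le> hi' J - lo' J \<and> gp' J \<le> hi I - lo I \<and> lo I + lo' J \<le> s \<and> s \<le> hi I + hi' J"

text \<open>Splitting the interval with the larger gap preserves interlocking: the two child sums overlap
  or touch because the other interval bridges the gap, the children are at least as long as the
  gap and hence bridge the smaller gap opposite, and their own gaps only got smaller.\<close>

lemma interlocked_split_left:
  assumes "gap_tree N lo hi gp" "I \<in> N" "0 < gp' J"
    and "interlocked lo hi gp lo' hi' gp' s I J" "gp' J \<le> gp I"
  shows "\<exists>I'\<in>N. interlocked lo hi gp lo' hi' gp' s I' J \<and> gp I' * gp' J \<le> 9/10 * (gp I * gp' J)"
proof -
  obtain a b where ab: "a \<in> N" "b \<in> N" "lo a \<le> lo I" "hi I \<le> hi b" "lo b - hi a \<le> gp I"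
        "gp I \<le> hi a - lo a" "gp I \<le> hi b - lo b"
        "gp a \<le> 9/10 * gp I" "gp b \<le> 9/10 * gp I"
    using gap_treeD(3)[OF assms(1,2)] by blast
  have pos: "0 < gp I" using gap_treeD(1)[OF assms(1,2)] .
  have prod: "gp c * gp' J \<le> 9/10 * (gp I * gp' J)" if "gp c \<le> 9/10 * gp I" for c
    using mult_right_mono[OF that, of "gp' J"] assms(3) by simp
  show ?thesis
  proof (cases "s \<le> hi a + hi' J")
    case True
    then have "interlocked lo hi gp lo' hi' gp' s a J"
      using assms(4,5) ab pos unfolding interlocked_def by linarith
    then show ?thesis using prod ab by blast
  next
    case False
    then have "interlocked lo hi gp lo' hi' gp' s b J"
      using assms(4,5) ab pos unfolding interlocked_def by linarith
    then show ?thesis using prod ab by blast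
  qed
qed

lemma interlocked_split:
  assumes "gap_tree N lo hi gp" "gap_tree N' lo' hi' gp'" "I \<in> N" "J \<in> N'"
    and "interlocked lo hi gp lo' hi' gp' s I J"
  shows "\<exists>I'\<in>N. \<exists>J'\<in>N'. interlocked lo hi gp lo' hi' gp' s I' J' \<and>
           gp I' * gp' J' \<le> 9/10 * (gp I * gp' J)"
proof (cases "gp' J \<le> gp I")
  case True
  then show ?thesis
    using interlocked_split_left[of N lo hi gp I gp' J] assms gap_treeD(1)[OF assms(2,4)] by blast
next
  case False
  have "interlocked lo' hi' gp' lo hi gp s J I"
    using assms(5) unfolding interlocked_def by auto
  with False obtain J' where "J' \<in> N'" "interlocked lo' hi' gp' lo hi gp s J' I"
    "gp' J' * gp I \<le> 9/10 * (gp' J * gp I)"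
    using interlocked_split_left[of N' lo' hi' gp' J gp I lo hi s] assms gap_treeD(1)[OF assms(1,3)]
    by auto
  then have "interlocked lo hi gp lo' hi' gp' s I J'" "gp I * gp' J' \<le> 9/10 * (gp I * gp' J)"
    unfolding interlocked_def by (auto simp: mult.commute)
  then show ?thesis using assms(3) \<open>J' \<in> N'\<close> by blast
qed

text \<open>Splitting repeatedly drives the product of the two gaps to 0. Interlocked nodes have
  comparable gaps, because each gap is at most the other length, which is at most 30 times the other gap;
  so both gaps become small.\<close>

lemma gap_tree_sum:
  assumes "gap_tree N lo hi gp" "gap_tree N' lo' hi' gp'" "I \<in> N" "J \<in> N'"
    and "interlocked lo hi gp lo' hi' gp' s I J" "\<epsilon> > 0"
  obtains I' J' where "I' \<in> N" "J' \<in> N'" "lo I' + lo' J' \<le> s" "s \<le> hi I' + hi' J'"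
    "gp I' < \<epsilon>" "gp' J' < \<epsilon>"
proof -
  define C where "C = gp I * gp' J"
  have C: "0 < C" using gap_treeD(1)[OF assms(1,3)] gap_treeD(1)[OF assms(2,4)] by (simp add: C_def)
  have it: "\<exists>I'\<in>N. \<exists>J'\<in>N'. interlocked lo hi gp lo' hi' gp' s I' J' \<and> gp I' * gp' J' \<le> (9/10)^k * C" for k
  proof (induction k)
    case 0
    then show ?case using assms by (auto simp: C_def)
  next
    case (Suc k)
    then obtain I1 J1 where 1: "I1 \<in> N" "J1 \<in> N'" "interlocked lo hi gp lo' hi' gp' s I1 J1"
      "gp I1 * gp' J1 \<le> (9/10)^k * C" by blast
    obtain I2 J2 where 2: "I2 \<in> N" "J2 \<in> N'" "interlocked lo hi gp lo' hi' gp' s I2 J2"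
      "gp I2 * gp' J2 \<le> 9/10 * (gp I1 * gp' J1)"
      using interlocked_split[OF assms(1,2) 1(1-3)] by blast
    have "gp I2 * gp' J2 \<le> (9/10)^Suc k * C" using 1(4) 2(4) by simp
    then show ?case using 2 by blast
  qed
  have "(\<lambda>k. (9/10::real)^k * (30 * C)) \<longlonglongrightarrow> 0 * (30 * C)"
    by (intro tendsto_mult LIMSEQ_power_zero) auto
  then have "eventually (\<lambda>k. (9/10::real)^k * (30 * C) < \<epsilon>\<^sup>2) sequentially"
    using assms(6) by (intro order_tendstoD(2)) auto
  then obtain k where k: "(9/10::real)^k * (30 * C) < \<epsilon>\<^sup>2"
    by (auto simp: eventually_sequentially)
  obtain I' J' where 1: "I' \<in> N" "J' \<in> N'" "interlocked lo hi gp lo' hi' gp' s I' J'"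
      "gp I' * gp' J' \<le> (9/10)^k * C" using it by blast
  have g: "0 < gp I'" "0 < gp' J'" "hi I' - lo I' \<le> 30 * gp I'" "hi' J' - lo' J' \<le> 30 * gp' J'"
    using gap_treeD[OF assms(1) 1(1)] gap_treeD[OF assms(2) 1(2)] by auto
  have i: "gp I' \<le> 30 * gp' J'" "gp' J' \<le> 30 * gp I'"
    using 1(3) g unfolding interlocked_def by auto
  have "(gp I')\<^sup>2 \<le> 30 * (gp I' * gp' J')" "(gp' J')\<^sup>2 \<le> 30 * (gp I' * gp' J')"
    using mult_left_mono[OF i(1), of "gp I'"] mult_left_mono[OF i(2), of "gp' J'"] g
    by (auto simp: power2_eq_square algebra_simps)
  then have "(gp I')\<^sup>2 < \<epsilon>\<^sup>2" "(gp' J')\<^sup>2 < \<epsilon>\<^sup>2" using 1(4) k by linarith+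
  then have "gp I' < \<epsilon>" "gp' J' < \<epsilon>" using assms(6) by (auto intro: power2_less_imp_less)
  then show ?thesis using that 1 unfolding interlocked_def by blast
qed

section \<open>A Cantor set of continued fractions\<close>

text \<open>A letter \<open>(a, e)\<close> stands for the map sending \<open>p\<close> to \<open>1 / (2 * (a + e * p))\<close>. Leaving out \<open>(3, 1)\<close>
  is essential: the interval of \<open>(3, 1)\<close> would be shorter than the gap next to it. The choice also
  makes a digit 1 be followed by \<open>+\<close> and a digit 3 by \<open>-\<close>.\<close>

definition letters :: "(real \<times> real) set" where
  "letters = {(1, 1), (2, -1), (2, 1), (3, -1)}"

text \<open>A word is a list of letters with its innermost letter first. The composed map is a
  fractional linear transformation, recorded by the partial fraction
  \<open>cyl_const w + cyl_scale w / (y + cyl_pole w)\<close> in the variable \<open>y = 1 / (2 * p)\<close>; in this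
  variable adding an innermost letter is the substitution of \<open>a + e / (2 * y)\<close> for \<open>y\<close>.\<close>

fun cyl_pole :: "(real \<times> real) list \<Rightarrow> real" where
  "cyl_pole [] = 0"
| "cyl_pole ((a, e) # w) = e / (2 * (a + cyl_pole w))"

fun cyl_scale :: "(real \<times> real) list \<Rightarrow> real" where
  "cyl_scale [] = 1 / 2"
| "cyl_scale ((a, e) # w) = - cyl_scale w * cyl_pole ((a, e) # w) / (a + cyl_pole w)"

fun cyl_const :: "(real \<times> real) list \<Rightarrow> real" where
  "cyl_const [] = 0"
| "cyl_const ((a, e) # w) = cyl_const w + cyl_scale w / (a + cyl_pole w)"

definition cyl :: "(real \<times> real) list \<Rightarrow> real \<Rightarrow> real" where
  "cyl w y = cyl_const w + cyl_scale w / (y + cyl_pole w)"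

text \<open>The pole is the word read backwards, again a continued fraction. It is negative only after a
  sign \<open>-\<close>, which requires a digit at least 2; hence the asymmetric bounds. They limit the
  distortion of the cylinder maps.\<close>

lemma cyl_pole_bounds: "set w \<subseteq> letters \<Longrightarrow> - 3/10 \<le> cyl_pole w \<and> cyl_pole w \<le> 18/25"
proof (induction w rule: cyl_pole.induct)
  case (2 a e w)
  then have B: "- 3/10 \<le> cyl_pole w" "cyl_pole w \<le> 18/25" by auto
  from 2 have "(a, e) \<in> letters" by simp
  then consider "e = 1" "a \<ge> 1" | "e = -1" "a \<ge> 2" by (auto simp: letters_def)
  then show ?case
    by cases (use B in \<open>auto simp: field_simps\<close>)
qed simp

lemma cyl_scale_nonzero: "set w \<subseteq> letters \<Longrightarrow> cyl_scale w \<noteq> 0"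
proof (induction w rule: cyl_scale.induct)
  case (2 a e w)
  then have B: "- 3/10 \<le> cyl_pole w" "cyl_pole w \<le> 18/25" "(a, e) \<in> letters" using cyl_pole_bounds[of w] by auto
  then show ?case using 2 by (auto simp: letters_def)
qed simp

lemma cyl_Nil: "cyl [] y = 1 / (2 * y)" by (simp add: cyl_def)

lemma cyl_Cons:
  assumes "set w \<subseteq> letters" "(a, e) \<in> letters" "y \<ge> 1"
  shows "cyl ((a, e) # w) y = cyl w (a + e / (2 * y))"
proof -
  have B: "- 3/10 \<le> cyl_pole w" "cyl_pole w \<le> 18/25" using cyl_pole_bounds[OF assms(1)] by auto
  have B': "- 3/10 \<le> cyl_pole ((a,e)#w)" using cyl_pole_bounds[of "(a,e)#w"] assms by auto
  define z where "z = a + cyl_pole w"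
  have z: "z > 0" using assms(2) B by (auto simp: z_def letters_def)
  have cyl_pole: "cyl_pole ((a,e)#w) = e / (2 * z)" by (simp add: z_def)
  have nz: "y + e / (2 * z) \<noteq> 0" "y \<noteq> 0" using assms(3) B' cyl_pole by auto
  have "z + e / (2 * y) = z * (y + e / (2 * z)) / y"
    using z nz(2) by (simp add: field_simps)
  then have "a + e / (2 * y) + cyl_pole w = z * (y + e / (2 * z)) / y"
    by (simp add: z_def algebra_simps)
  then have "cyl w (a + e / (2 * y)) = cyl_const w + cyl_scale w * y / (z * (y + e / (2 * z)))"
    by (simp add: cyl_def)
  also have "\<dots> = cyl_const w + cyl_scale w / z + (- cyl_scale w * (e / (2*z)) / z) / (y + e / (2 * z))"
  proof -
    define q where "q = y + e / (2 * z)"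
    have y: "y = q - e / (2 * z)" by (simp add: q_def)
    have "q \<noteq> 0" using nz q_def by simp
    then show ?thesis unfolding q_def[symmetric] unfolding y using z by (simp add: field_simps)
  qed
  also have "\<dots> = cyl ((a, e) # w) y" by (simp add: cyl_def z_def)
  finally show ?thesis ..
qed

text \<open>The length of the image of \<open>[x, y]\<close> under the cylinder map with pole parameter \<open>B\<close>, up to the factor \<open>cyl_scale\<close>.
  All comparisons of lengths within one word reduce to comparisons of this quantity.\<close>

definition rel_len :: "real \<Rightarrow> real \<Rightarrow> real \<Rightarrow> real" where
  "rel_len B x y = (y - x) / ((x + B) * (y + B))"

text \<open>After clearing denominators the inequality is quadratic in \<open>B\<close>. On the interval of possible
  \<open>B\<close> it suffices that its three Bernstein coefficients, which are the hypotheses \<open>c0\<close>, \<open>c1\<close>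
  and \<open>c2\<close>, have the right sign; with numerals in place of \<open>x\<close>, \<open>y\<close>, \<open>X\<close>, \<open>Y\<close> these are
  decided by arithmetic.\<close>

lemma rel_len_le:
  fixes B x y X Y c :: real
  assumes "- 3/10 \<le> B \<and> B \<le> 18/25" "1 \<le> x" "1 \<le> y" "1 \<le> X" "1 \<le> Y"
    and c0: "(y - x) * ((X - 3/10) * (Y - 3/10)) \<le> c * ((Y - X) * ((x - 3/10) * (y - 3/10)))"
    and c1: "(y - x) * ((X - 3/10) * (Y + 18/25) + (X + 18/25) * (Y - 3/10))
        \<le> c * ((Y - X) * ((x - 3/10) * (y + 18/25) + (x + 18/25) * (y - 3/10)))"
    and c2: "(y - x) * ((X + 18/25) * (Y + 18/25)) \<le> c * ((Y - X) * ((x + 18/25) * (y + 18/25)))"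
  shows "rel_len B x y \<le> c * rel_len B X Y"
proof -
  \<comment> \<open>barycentric coordinates of \<open>B\<close>; the factor \<open>51/50\<close> below is their sum\<close>
  define g h where "g = 18/25 - B" "h = B + 3/10"
  have gh: "0 \<le> g" "0 \<le> h" using assms(1) by (auto simp: g_h_def)
  have e: "(51/50)^2 * ((p + B) * (q + B)) = g^2 * ((p - 3/10) * (q - 3/10))
      + g * h * ((p - 3/10) * (q + 18/25) + (p + 18/25) * (q - 3/10))
      + h^2 * ((p + 18/25) * (q + 18/25))" for p q
  proof -
    have "51/50 * (p + B) = g * (p - 3/10) + h * (p + 18/25)" for p
      by (simp add: g_h_def field_simps)
    then have "(51/50 * (p + B)) * (51/50 * (q + B)) =
      (g * (p - 3/10) + h * (p + 18/25)) * (g * (q - 3/10) + h * (q + 18/25))" by (simp only:)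
    also have "\<dots> = g^2 * ((p - 3/10) * (q - 3/10))
      + g * h * ((p - 3/10) * (q + 18/25) + (p + 18/25) * (q - 3/10))
      + h^2 * ((p + 18/25) * (q + 18/25))" by algebra
    finally show ?thesis by (simp only: power2_eq_square mult_ac)
  qed
  have "(y - x) * ((51/50)^2 * ((X + B) * (Y + B))) \<le> c * ((Y - X) * ((51/50)^2 * ((x + B) * (y + B))))"
    unfolding e using mult_left_mono[OF c0, of "g^2"] mult_left_mono[OF c1, of "g * h"]
      mult_left_mono[OF c2, of "h^2"] gh
    by (simp only: distrib_left mult.left_commute[of _ "g^2"] mult.left_commute[of _ "h^2"]
        mult.left_commute[of _ "g * h"]) (simp add: mult_nonneg_nonneg)
  then have k: "(y - x) * ((X + B) * (Y + B)) \<le> c * ((Y - X) * ((x + B) * (y + B)))" by simp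
  have "0 < X + B" "0 < Y + B" "0 < x + B" "0 < y + B" using assms by auto
  then have pos: "0 < (X + B) * (Y + B)" "0 < (x + B) * (y + B)"
    and nz: "X + B \<noteq> 0" "Y + B \<noteq> 0" "x + B \<noteq> 0" "y + B \<noteq> 0" by simp_all
  have "rel_len B x y = (y - x) * ((X + B) * (Y + B)) / (((x + B) * (y + B)) * ((X + B) * (Y + B)))"
    using nz by (simp add: rel_len_def)
  also have "\<dots> \<le> c * ((Y - X) * ((x + B) * (y + B))) / (((x + B) * (y + B)) * ((X + B) * (Y + B)))"
    using k pos by (intro divide_right_mono) auto
  also have "\<dots> = c * rel_len B X Y"
    using nz by (simp add: rel_len_def)
  finally show ?thesis .
qed

lemma cyl_diff:
  assumes "set w \<subseteq> letters" "1 \<le> x" "1 \<le> y"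
  shows "cyl w x - cyl w y = cyl_scale w * rel_len (cyl_pole w) x y"
proof -
  have B: "- 3/10 \<le> cyl_pole w" using cyl_pole_bounds[OF assms(1)] by auto
  then have "x + cyl_pole w > 0" "y + cyl_pole w > 0" using assms by auto
  then show ?thesis by (simp add: cyl_def rel_len_def field_simps)
qed

text \<open>Left end, gap and right end of a node in the variable \<open>y = a + e * p\<close>. Type 0 is the interval from
  \<open>1 + 9/50\<close> to \<open>3 - 9/50\<close>, cut at \<open>2 - 9/50\<close> and \<open>2 + 9/50\<close>; the number \<open>9/50\<close> is slightly larger than
  the smallest fraction \<open>25/141 = 1 / (2 * (141/50))\<close> of type 0, so that extending the word by the four
  letters covers both parts. Type 1 carries the letters \<open>(1, 1)\<close> and \<open>(2, -1)\<close>, type 2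
  the letters \<open>(2, 1)\<close> and \<open>(3, -1)\<close>; their gaps \<open>(1 + 25/59, 2 - 25/59)\<close> and
  \<open>(2 + 25/59, 3 - 25/59)\<close> come from the largest fraction \<open>25/59 = 1 / (2 * (59/50))\<close>.\<close>

definition node_ends :: "nat \<Rightarrow> real \<times> real \<times> real \<times> real" where
  "node_ends t = (if t = 0 then (59/50, 91/50, 109/50, 141/50)
     else if t = 1 then (59/50, 84/59, 93/59, 91/50)
     else (109/50, 143/59, 152/59, 141/50))"

definition nodes :: "((real \<times> real) list \<times> nat) set" where
  "nodes = {w. set w \<subseteq> letters} \<times> {0, 1, 2}"

definition node_lo :: "(real \<times> real) list \<times> nat \<Rightarrow> real" where
  "node_lo = (\<lambda>(w, t). case node_ends t of (l, g, g', r) \<Rightarrow> min (cyl w l) (cyl w r))"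

definition node_hi :: "(real \<times> real) list \<times> nat \<Rightarrow> real" where
  "node_hi = (\<lambda>(w, t). case node_ends t of (l, g, g', r) \<Rightarrow> max (cyl w l) (cyl w r))"

definition node_gap :: "(real \<times> real) list \<times> nat \<Rightarrow> real" where
  "node_gap = (\<lambda>(w, t). case node_ends t of (l, g, g', r) \<Rightarrow> \<bar>cyl w g - cyl w g'\<bar>)"

lemma rel_len_nonneg: "- 3/10 \<le> B \<Longrightarrow> 1 \<le> x \<Longrightarrow> x \<le> y \<Longrightarrow> 0 \<le> rel_len B x y"
  by (simp add: rel_len_def)

lemma rel_len_pos: "- 3/10 \<le> B \<Longrightarrow> 1 \<le> x \<Longrightarrow> x < y \<Longrightarrow> 0 < rel_len B x y"
  by (simp add: rel_len_def)

lemma abs_cyl_diff: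
  assumes "set w \<subseteq> letters" "1 \<le> x" "x \<le> y"
  shows "\<bar>cyl w x - cyl w y\<bar> = \<bar>cyl_scale w\<bar> * rel_len (cyl_pole w) x y"
  using cyl_diff[of w x y] rel_len_nonneg[of "cyl_pole w" x y] cyl_pole_bounds[of w] assms by (simp add: abs_mult)

text \<open>One splitting step in the variable \<open>y\<close>: the children are the images of \<open>[x, g]\<close> and \<open>[g', x']\<close>,
  and all size conditions become inequalities between relative lengths. The cylinder map is
  monotone, but its direction depends on the signs in the word; if it is decreasing, the two
  children change places.\<close>

lemma split_node:
  assumes w: "set w \<subseteq> letters"
    and b: "node_ends t = (l, g, g', r)"
    and ord: "1 \<le> x" "x \<le> l" "l < g" "g < g'" "g' < r" "r \<le> x'"
    and c: "c \<in> nodes" "node_lo c = min (cyl w x) (cyl w g)" "node_hi c = max (cyl w x) (cyl w g)"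
      "node_gap c = \<bar>cyl w y - cyl w y'\<bar>" "1 \<le> y" "y \<le> y'"
    and c': "c' \<in> nodes" "node_lo c' = min (cyl w g') (cyl w x')" "node_hi c' = max (cyl w g') (cyl w x')"
      "node_gap c' = \<bar>cyl w z - cyl w z'\<bar>" "1 \<le> z" "z \<le> z'"
    and rel_len: "rel_len (cyl_pole w) g g' \<le> 1 * rel_len (cyl_pole w) x g" "rel_len (cyl_pole w) g g' \<le> 1 * rel_len (cyl_pole w) g' x'"
      "rel_len (cyl_pole w) y y' \<le> 9/10 * rel_len (cyl_pole w) g g'" "rel_len (cyl_pole w) z z' \<le> 9/10 * rel_len (cyl_pole w) g g'"
      "rel_len (cyl_pole w) l r \<le> 30 * rel_len (cyl_pole w) g g'"
  shows "0 < node_gap (w, t) \<and> node_hi (w, t) - node_lo (w, t) \<le> 30 * node_gap (w, t) \<and>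
     (\<exists>a\<in>nodes. \<exists>b\<in>nodes. node_lo a \<le> node_lo (w, t) \<and> node_hi (w, t) \<le> node_hi b \<and> node_lo b - node_hi a \<le> node_gap (w, t) \<and>
        node_gap (w, t) \<le> node_hi a - node_lo a \<and> node_gap (w, t) \<le> node_hi b - node_lo b \<and>
        node_gap a \<le> 9/10 * node_gap (w, t) \<and> node_gap b \<le> 9/10 * node_gap (w, t))"
proof -
  have B: "- 3/10 \<le> cyl_pole w" using cyl_pole_bounds[OF w] by auto
  have k: "0 < \<bar>cyl_scale w\<bar>" using cyl_scale_nonzero[OF w] by simp
  have eq: "node_lo (w, t) = min (cyl w l) (cyl w r)" "node_hi (w, t) = max (cyl w l) (cyl w r)"
     "node_gap (w, t) = \<bar>cyl w g - cyl w g'\<bar>"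
    by (simp_all add: node_lo_def node_hi_def node_gap_def b)
  have len: "max p q - min p q = \<bar>p - q\<bar>" for p q :: real by simp
  have dist: "\<bar>cyl w p - cyl w q\<bar> = \<bar>cyl_scale w\<bar> * rel_len (cyl_pole w) p q" if "1 \<le> p" "p \<le> q" for p q
    using abs_cyl_diff[OF w that] .
  have sc: "\<bar>cyl_scale w\<bar> * u \<le> m * (\<bar>cyl_scale w\<bar> * v)" if "u \<le> m * v" for u v m
    using mult_left_mono[OF that, of "\<bar>cyl_scale w\<bar>"] by (simp add: mult.left_commute)
  have pos: "0 < node_gap (w, t)" using dist[of g g'] rel_len_pos[OF B, of g g'] k ord by (simp add: eq)
  have L: "node_hi (w, t) - node_lo (w, t) \<le> 30 * node_gap (w, t)"
    unfolding eq len using dist[of l r] dist[of g g'] sc[OF rel_len(5)] ord by simp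
  have c1: "node_gap (w, t) \<le> node_hi c - node_lo c"
    unfolding eq c len using dist[of x g] dist[of g g'] sc[OF rel_len(1)] ord by simp
  have c2: "node_gap (w, t) \<le> node_hi c' - node_lo c'"
    unfolding eq c' len using dist[of g' x'] dist[of g g'] sc[OF rel_len(2)] ord by simp
  have g1: "node_gap c \<le> 9/10 * node_gap (w, t)"
    unfolding eq c using dist[of y y'] dist[of g g'] sc[OF rel_len(3)] ord c by simp
  have g2: "node_gap c' \<le> 9/10 * node_gap (w, t)"
    unfolding eq c' using dist[of z z'] dist[of g g'] sc[OF rel_len(4)] ord c' by simp
  show ?thesis
  proof (cases "0 < cyl_scale w")
    case True
    have dec: "cyl w q \<le> cyl w p" if "1 \<le> p" "p \<le> q" for p q
      using cyl_diff[OF w, of p q] rel_len_nonneg[OF B that] True that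
      by (metis diff_ge_0_iff_ge mult_nonneg_nonneg less_imp_le order_trans)
    have "node_lo c' \<le> node_lo (w, t)" "node_hi (w, t) \<le> node_hi c" "node_lo c - node_hi c' \<le> node_gap (w, t)"
      unfolding eq c c' using dec[of x l] dec[of l g] dec[of g g'] dec[of g' r] dec[of r x'] ord by auto
    with pos L c1 c2 g1 g2 c(1) c'(1) show ?thesis by blast
  next
    case False
    have inc: "cyl w p \<le> cyl w q" if "1 \<le> p" "p \<le> q" for p q
      using cyl_diff[OF w, of p q] mult_nonpos_nonneg[OF _ rel_len_nonneg[OF B that], of "cyl_scale w"] False that
      by auto
    have "node_lo c \<le> node_lo (w, t)" "node_hi (w, t) \<le> node_hi c'" "node_lo c' - node_hi c \<le> node_gap (w, t)"
      unfolding eq c c' using inc[of x l] inc[of l g] inc[of g g'] inc[of g' r] inc[of r x'] ord by auto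
    with pos L c1 c2 g1 g2 c(1) c'(1) show ?thesis by blast
  qed
qed

text \<open>A node of type 0 splits into the nodes of types 1 and 2 over the same word, and each of those
  splits into two nodes of type 0 over the word extended by a letter. The numbers below are
  the ends and gaps of these children transported to the variable \<open>y\<close> of the parent: for instance
  \<open>166/141 = 1 + 1 / (2 * (141/50))\<close> and \<open>134/109 = 1 + 1 / (2 * (109/50))\<close>.\<close>

lemma cantor_gap_tree: "gap_tree nodes node_lo node_hi node_gap"
  unfolding gap_tree_def
proof
  fix n assume "n \<in> nodes"
  then obtain w t where n: "n = (w, t)" and w: "set w \<subseteq> letters" and t: "t = 0 \<or> t = 1 \<or> t = 2"
    by (auto simp: nodes_def)
  note B = cyl_pole_bounds[OF w]
  have l: "(1, 1) \<in> letters" "(2, -1) \<in> letters" "(2, 1) \<in> letters" "(3, -1) \<in> letters"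
    by (auto simp: letters_def)
  have child: "(l # w, 0) \<in> nodes" if "l \<in> letters" for l
    using that w by (auto simp: nodes_def)
  have lo_child: "node_lo ((a, e) # w, 0) = min (cyl w (a + e * (25/59))) (cyl w (a + e * (25/141)))"
    and hi_child: "node_hi ((a, e) # w, 0) = max (cyl w (a + e * (25/59))) (cyl w (a + e * (25/141)))"
    and gp_child: "node_gap ((a, e) # w, 0) = \<bar>cyl w (a + e * (25/91)) - cyl w (a + e * (25/109))\<bar>"
    if "(a, e) \<in> letters" for a e
    by (simp_all add: node_lo_def node_hi_def node_gap_def node_ends_def cyl_Cons[OF w that])
  let ?G = "\<lambda>n. 0 < node_gap n \<and> node_hi n - node_lo n \<le> 30 * node_gap n \<and>
     (\<exists>a\<in>nodes. \<exists>b\<in>nodes. node_lo a \<le> node_lo n \<and> node_hi n \<le> node_hi b \<and> node_lo b - node_hi a \<le> node_gap n \<and>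
        node_gap n \<le> node_hi a - node_lo a \<and> node_gap n \<le> node_hi b - node_lo b \<and>
        node_gap a \<le> 9/10 * node_gap n \<and> node_gap b \<le> 9/10 * node_gap n)"
  from t show "?G n" unfolding n
  proof (elim disjE)
    assume t: "t = 0"
    have "(w, 1) \<in> nodes" "(w, 2) \<in> nodes" using w by (auto simp: nodes_def)
    then show "?G (w, t)" unfolding t
      by (intro split_node[OF w, of 0 "59/50" "91/50" "109/50" "141/50" "59/50" "141/50" "(w, 1)"
            "84/59" "93/59" "(w, 2)" "143/59" "152/59"] rel_len_le[OF B])
        (simp_all add: node_ends_def node_lo_def node_hi_def node_gap_def max.commute min.commute)
  next
    assume t: "t = 1"
    show "?G (w, t)" unfolding t
      by (rule split_node[OF w, of 1 "59/50" "84/59" "93/59" "91/50" "166/141" "257/141" "((1, 1) # w, 0)"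
            "134/109" "116/91" "((2, -1) # w, 0)" "157/91" "193/109"], unfold lo_child[OF l(1)]
            hi_child[OF l(1)] gp_child[OF l(1)] lo_child[OF l(2)] hi_child[OF l(2)] gp_child[OF l(2)],
            (intro rel_len_le[OF B] child l | simp add: node_ends_def max.commute min.commute abs_minus_commute)+)
  next
    assume t: "t = 2"
    show "?G (w, t)" unfolding t
      by (rule split_node[OF w, of 2 "109/50" "143/59" "152/59" "141/50" "307/141" "398/141" "((2, 1) # w, 0)"
            "243/109" "207/91" "((3, -1) # w, 0)" "248/91" "302/109"], unfold lo_child[OF l(3)]
            hi_child[OF l(3)] gp_child[OF l(3)] lo_child[OF l(4)] hi_child[OF l(4)] gp_child[OF l(4)],
            (intro rel_len_le[OF B] child l | simp add: node_ends_def max.commute min.commute abs_minus_commute)+)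
  qed
qed

lemma cyl_hull:
  assumes "set w \<subseteq> letters" "59/50 \<le> x" "x \<le> y" "y \<le> 141/50"
  shows "\<bar>cyl w x - cyl w y\<bar> \<le> \<bar>cyl_scale w\<bar> * rel_len (cyl_pole w) (59/50) (141/50)"
proof -
  note B = cyl_pole_bounds[OF assms(1)]
  have s: "rel_len (cyl_pole w) p q = 1 / (p + cyl_pole w) - 1 / (q + cyl_pole w)" if "1 \<le> p" "1 \<le> q" for p q
    using B that by (simp add: rel_len_def field_simps)
  have "rel_len (cyl_pole w) x y \<le> rel_len (cyl_pole w) (59/50) (141/50)"
    using B assms by (auto simp: s intro!: diff_mono divide_left_mono mult_pos_pos)
  then show ?thesis using abs_cyl_diff[OF assms(1), of x y] assms by (simp add: mult_left_mono)
qed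

text \<open>Every value of the cylinder map on the full interval of type 0 is close to the node, whatever
  the type of the node. This allows a finite word to be continued arbitrarily.\<close>

lemma node_hull:
  assumes "(w, t) \<in> nodes" "59/50 \<le> y" "y \<le> 141/50"
  shows "cyl w y \<le> node_lo (w, t) + 30 * node_gap (w, t)" "node_hi (w, t) - 30 * node_gap (w, t) \<le> cyl w y"
proof -
  have w: "set w \<subseteq> letters" and t: "t = 0 \<or> t = 1 \<or> t = 2" using assms(1) by (auto simp: nodes_def)
  note B = cyl_pole_bounds[OF w]
  define H where "H = \<bar>cyl_scale w\<bar> * rel_len (cyl_pole w) (59/50) (141/50)"
  have near: "\<bar>cyl w y - cyl w q\<bar> \<le> H" if "59/50 \<le> q" "q \<le> 141/50" for q
    using cyl_hull[OF w, of y q] cyl_hull[OF w, of q y] assms that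
    by (cases "y \<le> q") (auto simp: H_def abs_minus_commute)
  have *: "cyl w y \<le> node_lo (w, t) + 30 * node_gap (w, t) \<and> node_hi (w, t) - 30 * node_gap (w, t) \<le> cyl w y"
    if b: "node_ends t = (l, g, g', r)" and s: "rel_len (cyl_pole w) (59/50) (141/50) \<le> 30 * rel_len (cyl_pole w) g g'"
      and o: "1 \<le> g" "g \<le> g'" "59/50 \<le> l" "l \<le> 141/50" "59/50 \<le> r" "r \<le> 141/50" for l g g' r
  proof -
    have "H \<le> 30 * node_gap (w, t)"
      using mult_left_mono[OF s, of "\<bar>cyl_scale w\<bar>"] abs_cyl_diff[OF w o(1,2)] by (simp add: H_def node_gap_def b)
    then show ?thesis
      using near[OF o(3,4)] near[OF o(5,6)] by (auto simp: node_lo_def node_hi_def b)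
  qed
  have "cyl w y \<le> node_lo (w, t) + 30 * node_gap (w, t) \<and> node_hi (w, t) - 30 * node_gap (w, t) \<le> cyl w y"
    using t
  proof (elim disjE)
    assume "t = 0"
    then show ?thesis
      by (intro *[of "59/50" "91/50" "109/50" "141/50"] rel_len_le[OF B]) (simp_all add: node_ends_def)
  next
    assume "t = 1"
    then show ?thesis
      by (intro *[of "59/50" "84/59" "93/59" "91/50"] rel_len_le[OF B]) (simp_all add: node_ends_def)
  next
    assume "t = 2"
    then show ?thesis
      by (intro *[of "109/50" "143/59" "152/59" "141/50"] rel_len_le[OF B]) (simp_all add: node_ends_def)
  qed
  then show "cyl w y \<le> node_lo (w, t) + 30 * node_gap (w, t)" "node_hi (w, t) - 30 * node_gap (w, t) \<le> cyl w y" by auto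
qed

lemma root_node: "([], 0) \<in> nodes" "node_lo ([], 0) = 25/141" "node_hi ([], 0) = 25/59"
  "node_gap ([], 0) \<le> 25/59 - 25/141"
  by (simp_all add: nodes_def node_lo_def node_hi_def node_gap_def node_ends_def cyl_Nil)

lemma cantor_sum:
  assumes "50/141 \<le> s" "s \<le> 50/59" "\<epsilon> > 0"
  obtains w w' where "set w \<subseteq> letters" "set w' \<subseteq> letters"
    "\<And>y y'. 59/50 \<le> y \<Longrightarrow> y \<le> 141/50 \<Longrightarrow> 59/50 \<le> y' \<Longrightarrow> y' \<le> 141/50 \<Longrightarrow>
       \<bar>s - (cyl w y + cyl w' y')\<bar> \<le> \<epsilon>"
proof -
  have "interlocked node_lo node_hi node_gap node_lo node_hi node_gap s ([], 0) ([], 0)"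
    using assms root_node unfolding interlocked_def by simp
  then obtain I J where IJ: "I \<in> nodes" "J \<in> nodes" "node_lo I + node_lo J \<le> s" "s \<le> node_hi I + node_hi J"
    "node_gap I < \<epsilon>/60" "node_gap J < \<epsilon>/60"
    by (rule gap_tree_sum[OF cantor_gap_tree cantor_gap_tree root_node(1) root_node(1), of s "\<epsilon>/60"])
      (use assms in simp)
  obtain w t w' t' where e: "I = (w, t)" "J = (w', t')" by fastforce
  show ?thesis
  proof
    show "set w \<subseteq> letters" "set w' \<subseteq> letters" using IJ e by (auto simp: nodes_def)
    fix y y' :: real assume y: "59/50 \<le> y" "y \<le> 141/50" "59/50 \<le> y'" "y' \<le> 141/50"
    show "\<bar>s - (cyl w y + cyl w' y')\<bar> \<le> \<epsilon>"
      using node_hull[OF IJ(1)[unfolded e] y(1,2)] node_hull[OF IJ(2)[unfolded e] y(3,4)] IJ(3-)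
      unfolding e abs_le_iff by linarith
  qed
qed

lemma cantor_difference:
  assumes "25/141 - 25/59 \<le> s" "s \<le> 25/59 - 25/141" "\<epsilon> > 0"
  obtains w w' where "set w \<subseteq> letters" "set w' \<subseteq> letters"
    "\<And>y y'. 59/50 \<le> y \<Longrightarrow> y \<le> 141/50 \<Longrightarrow> 59/50 \<le> y' \<Longrightarrow> y' \<le> 141/50 \<Longrightarrow>
       \<bar>s - (cyl w y - cyl w' y')\<bar> \<le> \<epsilon>"
proof -
  have "interlocked node_lo node_hi node_gap (\<lambda>n. - node_hi n) (\<lambda>n. - node_lo n) node_gap s ([], 0) ([], 0)"
    using assms root_node unfolding interlocked_def by simp
  then obtain I J where IJ: "I \<in> nodes" "J \<in> nodes" "node_lo I + - node_hi J \<le> s" "s \<le> node_hi I + - node_lo J"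
    "node_gap I < \<epsilon>/60" "node_gap J < \<epsilon>/60"
    by (rule gap_tree_sum[OF cantor_gap_tree gap_tree_reflect[OF cantor_gap_tree] root_node(1) root_node(1),
      of s "\<epsilon>/60"]) (use assms in simp)
  obtain w t w' t' where e: "I = (w, t)" "J = (w', t')" by fastforce
  show ?thesis
  proof
    show "set w \<subseteq> letters" "set w' \<subseteq> letters" using IJ e by (auto simp: nodes_def)
    fix y y' :: real assume y: "59/50 \<le> y" "y \<le> 141/50" "59/50 \<le> y'" "y' \<le> 141/50"
    show "\<bar>s - (cyl w y - cyl w' y')\<bar> \<le> \<epsilon>"
      using node_hull[OF IJ(1)[unfolded e] y(1,2)] node_hull[OF IJ(2)[unfolded e] y(3,4)] IJ(3-)
      unfolding e abs_le_iff by linarith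
  qed
qed

text \<open>With \<open>C\<close> the limit set, \<open>C - C\<close> contains the numbers of absolute value at most
  \<open>25/59 - 25/141 > 24/100\<close>, and \<open>C + C\<close> contains everything from \<open>50/141 < 36/100\<close> to
  \<open>50/59 > 84/100\<close>. Modulo 1 these intervals and the negative of the second one cover everything;
  the case distinction is by the fractional part of \<open>\<mu>\<close>. The signs and the integer do not
  depend on the precision \<open>\<epsilon>\<close>.\<close>

lemma cantor_ray:
  assumes "\<mu> \<ge> 4"
  obtains a :: int and \<sigma> \<tau> :: real where "a \<ge> 4" "\<sigma> = 1 \<or> \<sigma> = -1" "\<tau> = 1 \<or> \<tau> = -1"
    "\<forall>\<epsilon>>0. \<exists>w w'. set w \<subseteq> letters \<and> set w' \<subseteq> letters \<and>
       (\<forall>y y'. 59/50 \<le> y \<longrightarrow> y \<le> 141/50 \<longrightarrow> 59/50 \<le> y' \<longrightarrow> y' \<le> 141/50 \<longrightarrow>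
         \<bar>\<mu> - (of_int a + \<sigma> * cyl w y + \<tau> * cyl w' y')\<bar> \<le> \<epsilon>)"
proof -
  define f where "f = frac \<mu>"
  have f: "0 \<le> f" "f < 1" "\<mu> = of_int \<lfloor>\<mu>\<rfloor> + f" using frac_lt_1[of \<mu>] by (auto simp: f_def frac_def)
  have fl: "\<lfloor>\<mu>\<rfloor> \<ge> 4" using assms by linarith
  consider "f \<le> 24/100" | "24/100 \<le> f" "f \<le> 64/100" | "64/100 \<le> f" "f \<le> 84/100" | "84/100 \<le> f"
    by linarith
  then show ?thesis
  proof cases
    case 1
    show ?thesis
    proof (rule that[of "\<lfloor>\<mu>\<rfloor>" 1 "-1", OF _ _ _ allI[OF impI]])
      fix \<epsilon> :: real assume "\<epsilon> > 0"
      with 1 f obtain w w' where w: "set w \<subseteq> letters" "set w' \<subseteq> letters"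
        "\<And>y y'. 59/50 \<le> y \<Longrightarrow> y \<le> 141/50 \<Longrightarrow> 59/50 \<le> y' \<Longrightarrow> y' \<le> 141/50 \<Longrightarrow>
          \<bar>f - (cyl w y - cyl w' y')\<bar> \<le> \<epsilon>"
        using cantor_difference[of f \<epsilon>] by auto
      show "\<exists>w w'. set w \<subseteq> letters \<and> set w' \<subseteq> letters \<and>
       (\<forall>y y'. 59/50 \<le> y \<longrightarrow> y \<le> 141/50 \<longrightarrow> 59/50 \<le> y' \<longrightarrow> y' \<le> 141/50 \<longrightarrow>
         \<bar>\<mu> - (of_int \<lfloor>\<mu>\<rfloor> + 1 * cyl w y + -1 * cyl w' y')\<bar> \<le> \<epsilon>)"
      proof (rule exI[of _ w], rule exI[of _ w'], intro conjI w(1) w(2) allI impI)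
        fix y y' :: real assume "59/50 \<le> y" "y \<le> 141/50" "59/50 \<le> y'" "y' \<le> 141/50"
        from w(3)[OF this] f(3) show "\<bar>\<mu> - (of_int \<lfloor>\<mu>\<rfloor> + 1 * cyl w y + -1 * cyl w' y')\<bar> \<le> \<epsilon>"
          by (simp add: abs_le_iff)
      qed
    qed (use fl in auto)
  next
    case 2
    show ?thesis
    proof (rule that[of "\<lfloor>\<mu>\<rfloor> + 1" "-1" "-1", OF _ _ _ allI[OF impI]])
      fix \<epsilon> :: real assume "\<epsilon> > 0"
      with 2 f obtain w w' where w: "set w \<subseteq> letters" "set w' \<subseteq> letters"
        "\<And>y y'. 59/50 \<le> y \<Longrightarrow> y \<le> 141/50 \<Longrightarrow> 59/50 \<le> y' \<Longrightarrow> y' \<le> 141/50 \<Longrightarrow>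
          \<bar>(1 - f) - (cyl w y + cyl w' y')\<bar> \<le> \<epsilon>"
        using cantor_sum[of "1 - f" \<epsilon>] by auto
      show "\<exists>w w'. set w \<subseteq> letters \<and> set w' \<subseteq> letters \<and>
       (\<forall>y y'. 59/50 \<le> y \<longrightarrow> y \<le> 141/50 \<longrightarrow> 59/50 \<le> y' \<longrightarrow> y' \<le> 141/50 \<longrightarrow>
         \<bar>\<mu> - (of_int (\<lfloor>\<mu>\<rfloor> + 1) + -1 * cyl w y + -1 * cyl w' y')\<bar> \<le> \<epsilon>)"
      proof (rule exI[of _ w], rule exI[of _ w'], intro conjI w(1) w(2) allI impI)
        fix y y' :: real assume "59/50 \<le> y" "y \<le> 141/50" "59/50 \<le> y'" "y' \<le> 141/50"
        from w(3)[OF this] f(3) show "\<bar>\<mu> - (of_int (\<lfloor>\<mu>\<rfloor> + 1) + -1 * cyl w y + -1 * cyl w' y')\<bar> \<le> \<epsilon>"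
          by (simp add: abs_le_iff)
      qed
    qed (use fl in auto)
  next
    case 3
    show ?thesis
    proof (rule that[of "\<lfloor>\<mu>\<rfloor>" 1 1, OF _ _ _ allI[OF impI]])
      fix \<epsilon> :: real assume "\<epsilon> > 0"
      with 3 f obtain w w' where w: "set w \<subseteq> letters" "set w' \<subseteq> letters"
        "\<And>y y'. 59/50 \<le> y \<Longrightarrow> y \<le> 141/50 \<Longrightarrow> 59/50 \<le> y' \<Longrightarrow> y' \<le> 141/50 \<Longrightarrow>
          \<bar>f - (cyl w y + cyl w' y')\<bar> \<le> \<epsilon>"
        using cantor_sum[of f \<epsilon>] by auto
      show "\<exists>w w'. set w \<subseteq> letters \<and> set w' \<subseteq> letters \<and>
       (\<forall>y y'. 59/50 \<le> y \<longrightarrow> y \<le> 141/50 \<longrightarrow> 59/50 \<le> y' \<longrightarrow> y' \<le> 141/50 \<longrightarrow>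
         \<bar>\<mu> - (of_int \<lfloor>\<mu>\<rfloor> + 1 * cyl w y + 1 * cyl w' y')\<bar> \<le> \<epsilon>)"
      proof (rule exI[of _ w], rule exI[of _ w'], intro conjI w(1) w(2) allI impI)
        fix y y' :: real assume "59/50 \<le> y" "y \<le> 141/50" "59/50 \<le> y'" "y' \<le> 141/50"
        from w(3)[OF this] f(3) show "\<bar>\<mu> - (of_int \<lfloor>\<mu>\<rfloor> + 1 * cyl w y + 1 * cyl w' y')\<bar> \<le> \<epsilon>"
          by (simp add: abs_le_iff)
      qed
    qed (use fl in auto)
  next
    case 4
    show ?thesis
    proof (rule that[of "\<lfloor>\<mu>\<rfloor> + 1" 1 "-1", OF _ _ _ allI[OF impI]])
      fix \<epsilon> :: real assume "\<epsilon> > 0"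
      with 4 f obtain w w' where w: "set w \<subseteq> letters" "set w' \<subseteq> letters"
        "\<And>y y'. 59/50 \<le> y \<Longrightarrow> y \<le> 141/50 \<Longrightarrow> 59/50 \<le> y' \<Longrightarrow> y' \<le> 141/50 \<Longrightarrow>
          \<bar>(f - 1) - (cyl w y - cyl w' y')\<bar> \<le> \<epsilon>"
        using cantor_difference[of "f - 1" \<epsilon>] by auto
      show "\<exists>w w'. set w \<subseteq> letters \<and> set w' \<subseteq> letters \<and>
       (\<forall>y y'. 59/50 \<le> y \<longrightarrow> y \<le> 141/50 \<longrightarrow> 59/50 \<le> y' \<longrightarrow> y' \<le> 141/50 \<longrightarrow>
         \<bar>\<mu> - (of_int (\<lfloor>\<mu>\<rfloor> + 1) + 1 * cyl w y + -1 * cyl w' y')\<bar> \<le> \<epsilon>)"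
      proof (rule exI[of _ w], rule exI[of _ w'], intro conjI w(1) w(2) allI impI)
        fix y y' :: real assume "59/50 \<le> y" "y \<le> 141/50" "59/50 \<le> y'" "y' \<le> 141/50"
        from w(3)[OF this] f(3) show "\<bar>\<mu> - (of_int (\<lfloor>\<mu>\<rfloor> + 1) + 1 * cyl w y + -1 * cyl w' y')\<bar> \<le> \<epsilon>"
          by (simp add: abs_le_iff)
      qed
    qed (use fl in auto)
  qed
qed

section \<open>Signed continued fractions and their convergents\<close>

text \<open>The three-term recurrence of numerators and denominators; the sign \<open>e n\<close> precedes the digit \<open>a n\<close>.\<close>

fun recurrence :: "(nat \<Rightarrow> real) \<Rightarrow> (nat \<Rightarrow> real) \<Rightarrow> real \<Rightarrow> real \<Rightarrow> nat \<Rightarrow> real" where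
  "recurrence a e x y 0 = x"
| "recurrence a e x y (Suc 0) = y"
| "recurrence a e x y (Suc (Suc n)) = sqrt 2 * a n * recurrence a e x y (Suc n) + e n * recurrence a e x y n"

text \<open>One step of the fraction. The hypotheses say that after a sign \<open>-\<close> the subtracted fraction is at
  most \<open>1/2\<close>, and at most \<open>1/3\<close> below a digit 1; the conclusion is strong enough to feed
  the next step. It serves for reading forwards and backwards.\<close>

lemma inverse_bound:
  fixes a s tail :: real
  assumes "a = 1 \<or> a \<ge> 2" "s = 1 \<or> s = -1" "0 \<le> tail"
    and "s = -1 \<Longrightarrow> tail \<le> 1/2" "s = -1 \<Longrightarrow> a = 1 \<Longrightarrow> tail \<le> 1/3"
  shows "2/3 \<le> a + s * tail" "0 < 1 / (2 * (a + s * tail))"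
    "1 / (2 * (a + s * tail)) \<le> (if a \<ge> 2 then 1/3 else if s = 1 then 1/2 else 3/4)"
proof -
  show 1: "2/3 \<le> a + s * tail" using assms by auto
  then show "0 < 1 / (2 * (a + s * tail))" by simp
  show "1 / (2 * (a + s * tail)) \<le> (if a \<ge> 2 then 1/3 else if s = 1 then 1/2 else 3/4)"
    using assms 1 by (auto simp: divide_le_eq)
qed

text \<open>The sign rules are invariant under reversal of the sequence. They keep all denominators
  \<open>a n + e (Suc n) * x\<close> away from 0, and \<open>three_signs\<close> keeps the value at a digit 3 below 4. The
  sign \<open>e 0 = 1\<close> matches the starting values of the recurrence, for which the first tail is
  positive.\<close>

locale digits =
  fixes a e :: "nat \<Rightarrow> real"
  assumes a_int: "a n \<in> \<int>" and a_ge: "1 \<le> a n"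
    and e_sign: "e n = 1 \<or> e n = -1" and e_0: "e 0 = 1"
    and ones: "e (Suc n) = -1 \<Longrightarrow> \<not> (a n = 1 \<and> a (Suc n) = 1)"
    and one_signs: "a n = 1 \<Longrightarrow> e n = -1 \<Longrightarrow> e (Suc n) = -1 \<Longrightarrow> False"
    and three_signs: "a n = 3 \<Longrightarrow> e n = -1 \<or> e (Suc n) = -1"
begin

lemma a_cases: "a n = 1 \<or> a n \<ge> 2" "a n \<le> 3 \<Longrightarrow> a n = 1 \<or> a n = 2 \<or> a n = 3"
proof -
  obtain k :: int where k: "a n = of_int k" using a_int[of n] by (auto elim: Ints_cases)
  have "k \<ge> 1" using a_ge[of n] k by simp
  then have "k = 1 \<or> k \<ge> 2" by linarith
  then show "a n = 1 \<or> a n \<ge> 2" unfolding k by auto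
  assume "a n \<le> 3"
  then have "k \<le> 3" using k by simp
  then have "k = 1 \<or> k = 2 \<or> k = 3" using \<open>k \<ge> 1\<close> by linarith
  then show "a n = 1 \<or> a n = 2 \<or> a n = 3" unfolding k by auto
qed

text \<open>A bound for the tail at position \<open>n\<close> that only looks at the digit there and the sign after it.\<close>

definition tail_sup :: "nat \<Rightarrow> real" where
  "tail_sup n = (if a n \<ge> 2 then 1/3 else if e (Suc n) = 1 then 1/2 else 3/4)"

lemma tail_sup_bounds: "0 < tail_sup n" "tail_sup n \<le> 3/4" by (auto simp: tail_sup_def)

lemma tail_sup_next:
  assumes "e (Suc n) = -1"
  shows "tail_sup (Suc n) \<le> 1/2" "a n = 1 \<Longrightarrow> tail_sup (Suc n) \<le> 1/3"
proof -
  show "tail_sup (Suc n) \<le> 1/2"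
    using a_cases(1)[of "Suc n"] one_signs[of "Suc n"] e_sign[of "Suc (Suc n)"] assms
    by (auto simp: tail_sup_def)
  assume "a n = 1"
  then show "tail_sup (Suc n) \<le> 1/3" using ones[OF assms] a_cases(1)[of "Suc n"] by (auto simp: tail_sup_def)
qed

definition cf_step :: "nat \<Rightarrow> real \<Rightarrow> real" where
  "cf_step n tail = 1 / (2 * (a n + e (Suc n) * tail))"

lemma cf_step_bounds:
  assumes "0 \<le> tail" "tail \<le> tail_sup (Suc n)"
  shows "2/3 \<le> a n + e (Suc n) * tail" "0 < cf_step n tail" "cf_step n tail \<le> tail_sup n"
  unfolding cf_step_def tail_sup_def
  by (rule inverse_bound; use assms a_cases(1)[of n] e_sign[of "Suc n"] tail_sup_next[of n] in force)+

text \<open>Possible tails at position \<open>n\<close> if nothing is known about the tail \<open>m\<close> steps later but its bound.\<close>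

fun tail_range :: "nat \<Rightarrow> nat \<Rightarrow> real set" where
  "tail_range n 0 = {0..tail_sup n}"
| "tail_range n (Suc m) = cf_step n ` tail_range (Suc n) m"

lemma tail_range_sub: "tail_range n m \<subseteq> {0..tail_sup n}"
proof (induction m arbitrary: n)
  case (Suc m)
  show ?case
  proof
    fix x assume "x \<in> tail_range n (Suc m)"
    then obtain tail where tail: "tail \<in> tail_range (Suc n) m" "x = cf_step n tail" by auto
    then have "0 \<le> tail" "tail \<le> tail_sup (Suc n)" using Suc[of "Suc n"] by auto
    then show "x \<in> {0..tail_sup n}" using cf_step_bounds[of tail n] tail by auto
  qed
qed simp

lemma tail_range_nonempty: "tail_range n m \<noteq> {}"
  using tail_sup_bounds(1) by (induction m arbitrary: n) (auto simp: less_imp_le)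

lemma tail_range_mono: "tail_range n (Suc m) \<subseteq> tail_range n m"
proof (induction m arbitrary: n)
  case 0
  show ?case using tail_range_sub[of n 1] by simp
next
  case (Suc m)
  then show ?case by (metis tail_range.simps(2) image_mono)
qed

lemma tail_range_compact: "compact (tail_range n m)"
proof (induction m arbitrary: n)
  case (Suc m)
  have "continuous_on (tail_range (Suc n) m) (cf_step n)"
    unfolding cf_step_def
  proof (intro continuous_intros ballI)
    fix tail assume "tail \<in> tail_range (Suc n) m"
    then have "2/3 \<le> a n + e (Suc n) * tail" using tail_range_sub[of "Suc n" m] by (intro cf_step_bounds(1)) auto
    then show "2 * (a n + e (Suc n) * tail) \<noteq> 0" by simp
  qed
  then show ?case using compact_continuous_image[OF _ Suc[of "Suc n"]] by simp
qed simp

lemma cf_step_inj: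
  assumes "s \<in> {0..tail_sup (Suc n)}" "tail \<in> {0..tail_sup (Suc n)}" "cf_step n s = cf_step n tail"
  shows "s = tail"
proof -
  have "2/3 \<le> a n + e (Suc n) * s" "2/3 \<le> a n + e (Suc n) * tail" using assms cf_step_bounds(1) by auto
  then have "a n + e (Suc n) * s = a n + e (Suc n) * tail" using assms(3) by (simp add: cf_step_def field_simps)
  then show ?thesis using e_sign[of "Suc n"] by auto
qed

text \<open>The individual steps need not be contractions, so the tails are found by compactness: nested
  compact sets have a common point, and since each step is injective a common point at
  position \<open>n\<close> determines one at position \<open>Suc n\<close>.\<close>

lemma tails_exist: "\<exists>tail. \<forall>n. 0 \<le> tail n \<and> tail n \<le> tail_sup n \<and> tail n = cf_step n (tail (Suc n))"
proof -
  have "\<exists>tail. \<forall>n. tail n \<in> (\<Inter>m. tail_range n m) \<and> tail n = cf_step n (tail (Suc n))"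
  proof (rule dependent_nat_choice[where P = "\<lambda>n x. x \<in> (\<Inter>m. tail_range n m)" and Q = "\<lambda>n x y. x = cf_step n y"])
    have "(\<Inter>m. tail_range 0 m) \<noteq> {}"
    proof (rule compact_nest)
      show "tail_range 0 n \<subseteq> tail_range 0 m" if "m \<le> n" for m n
        by (rule lift_Suc_antimono_le[where f = "tail_range 0", OF _ that]) (rule tail_range_mono)
    qed (rule tail_range_compact tail_range_nonempty)+
    then show "\<exists>x. x \<in> (\<Inter>m. tail_range 0 m)" by blast
  next
    fix x n assume x: "x \<in> (\<Inter>m. tail_range n m)"
    have "\<forall>m. \<exists>y. y \<in> tail_range (Suc n) m \<and> x = cf_step n y"
    proof
      fix m
      have "x \<in> tail_range n (Suc m)" using x by blast
      then show "\<exists>y. y \<in> tail_range (Suc n) m \<and> x = cf_step n y" by auto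
    qed
    from choice[OF this] obtain y where "\<forall>m. y m \<in> tail_range (Suc n) m \<and> x = cf_step n (y m)" ..
    then have y: "y m \<in> tail_range (Suc n) m" "x = cf_step n (y m)" for m by blast+
    have "y m = y 0" for m
    proof (rule cf_step_inj[of _ n])
      show "y m \<in> {0..tail_sup (Suc n)}" "y 0 \<in> {0..tail_sup (Suc n)}" using y(1) tail_range_sub by blast+
      show "cf_step n (y m) = cf_step n (y 0)" using y(2)[of m] y(2)[of 0] by simp
    qed
    then have "y 0 \<in> (\<Inter>m. tail_range (Suc n) m)" using y(1) by (intro INT_I) (metis)
    then show "\<exists>y. y \<in> (\<Inter>m. tail_range (Suc n) m) \<and> x = cf_step n y" using y(2) by blast
  qed
  then obtain tail where tail: "\<And>n. tail n \<in> (\<Inter>m. tail_range n m)" "\<And>n. tail n = cf_step n (tail (Suc n))" by blast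
  have "0 \<le> tail n \<and> tail n \<le> tail_sup n" for n
  proof -
    have "tail n \<in> tail_range n 0" using tail(1) by blast
    then show ?thesis by simp
  qed
  then show ?thesis using tail(2) by blast
qed

definition tail :: "nat \<Rightarrow> real" where
  "tail = (SOME tail. \<forall>n. 0 \<le> tail n \<and> tail n \<le> tail_sup n \<and> tail n = cf_step n (tail (Suc n)))"

lemma tail_bounds: "tail n \<le> tail_sup n" and tail_step: "tail n = 1 / (2 * (a n + e (Suc n) * tail (Suc n)))"
  and tail_pos: "0 < tail n"
proof -
  have *: "\<forall>n. 0 \<le> tail n \<and> tail n \<le> tail_sup n \<and> tail n = cf_step n (tail (Suc n))"
    unfolding tail_def by (rule someI_ex[OF tails_exist])
  then show "tail n \<le> tail_sup n" by blast
  have "tail n = cf_step n (tail (Suc n))" using * by blast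
  then show "tail n = 1 / (2 * (a n + e (Suc n) * tail (Suc n)))" by (simp only: cf_step_def)
  have "0 < cf_step n (tail (Suc n))" using * by (intro cf_step_bounds(2)) blast+
  then show "0 < tail n" using \<open>tail n = cf_step n (tail (Suc n))\<close> by simp
qed

lemma tail_inverse: "1 / (2 * tail n) = a n + e (Suc n) * tail (Suc n)"
  by (subst tail_step[of n]) simp

text \<open>The fraction read backwards from position \<open>n\<close>; it is the quotient of consecutive denominators
  up to the factor \<open>sqrt 2\<close>.\<close>

fun past :: "nat \<Rightarrow> real" where
  "past 0 = 0"
| "past (Suc n) = 1 / (2 * (a n + e n * past n))"

text \<open>Growth factor of the denominators, up to \<open>sqrt 2\<close>.\<close>

definition growth :: "nat \<Rightarrow> real" where "growth n = a n + e n * past n"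

lemma past_bounds:
  "0 \<le> past n \<and> past n \<le> 3/4 \<and> (e n = -1 \<longrightarrow> past n \<le> 1/2) \<and> (e n = -1 \<longrightarrow> a n = 1 \<longrightarrow> past n \<le> 1/3)"
proof (induction n)
  case (Suc n)
  have "0 < past (Suc n)" "past (Suc n) \<le> (if a n \<ge> 2 then 1/3 else if e n = 1 then 1/2 else 3/4)"
    unfolding past.simps
    by (rule inverse_bound; use Suc a_cases(1)[of n] e_sign[of n] in force)+
  then show ?case using one_signs[of n] ones[of n] e_sign[of n] e_sign[of "Suc n"] a_cases(1)[of n]
    by (auto split: if_splits simp del: past.simps)
qed simp

lemma growth_ge: "2/3 \<le> growth n" and growth_ge': "a n \<ge> 2 \<Longrightarrow> 3/2 \<le> growth n" "e n = 1 \<Longrightarrow> a n \<le> growth n"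
  using past_bounds[of n] a_cases(1)[of n] e_sign[of n] by (auto simp: growth_def)

lemma growth_low: "growth n < 1 \<Longrightarrow> a n = 1 \<and> e n = -1"
  using growth_ge'[of n] a_cases(1)[of n] e_sign[of n] by force

text \<open>Up to \<open>sqrt 2\<close>, the reciprocal of the form at the convergent of index \<open>Suc n\<close>.\<close>

definition spot :: "nat \<Rightarrow> real" where "spot n = growth n + e (Suc n) * tail (Suc n)"

lemma spot_ge: "2/3 * growth n \<le> spot n" and spot_ge': "growth n < 1 \<Longrightarrow> growth n \<le> spot n"
proof -
  note tb = tail_pos[of "Suc n"] tail_bounds[of "Suc n"]
  show "2/3 * growth n \<le> spot n"
  proof (cases "e (Suc n) = 1")
    case True
    then show ?thesis using tb growth_ge[of n] by (simp add: spot_def)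
  next
    case False
    then have e: "e (Suc n) = -1" using e_sign by blast
    show ?thesis
    proof (cases "a n = 1")
      case True
      then have "e n = 1" using one_signs[of n] e e_sign by blast
      then have "1 \<le> growth n" using growth_ge'(2)[of n] True by simp
      moreover have "tail (Suc n) \<le> 1/3" using tail_sup_next(2)[OF e True] tb by simp
      ultimately show ?thesis by (simp add: spot_def e)
    next
      case False
      then have "3/2 \<le> growth n" using growth_ge'(1)[of n] a_cases(1)[of n] by blast
      moreover have "tail (Suc n) \<le> 1/2" using tail_sup_next(1)[OF e] tb by simp
      ultimately show ?thesis by (simp add: spot_def e)
    qed
  qed
  assume "growth n < 1"
  then have "e (Suc n) = 1" using growth_low[of n] one_signs[of n] e_sign[of "Suc n"] by blast
  then show "growth n \<le> spot n" using tb by (simp add: spot_def)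
qed

lemma spot_pos: "0 < spot n" using spot_ge[of n] growth_ge[of n] by linarith

text \<open>Each fraction contributes at most \<open>3/4\<close>, and at a digit 3 at least one of them is subtracted.\<close>

lemma spot_le: "a n \<le> 3 \<Longrightarrow> spot n \<le> 4"
proof -
  assume "a n \<le> 3"
  then have c: "a n = 1 \<or> a n = 2 \<or> a n = 3" by (rule a_cases(2))
  have "0 \<le> past n" "past n \<le> 3/4" "0 < tail (Suc n)" "tail (Suc n) \<le> 3/4"
    using past_bounds[of n] tail_pos[of "Suc n"] tail_bounds[of "Suc n"] tail_sup_bounds[of "Suc n"] by auto
  then have 1: "e n * past n \<le> 3/4" "e (Suc n) * tail (Suc n) \<le> 3/4"
    "e n = -1 \<Longrightarrow> e n * past n \<le> 0" "e (Suc n) = -1 \<Longrightarrow> e (Suc n) * tail (Suc n) \<le> 0"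
    using e_sign[of n] e_sign[of "Suc n"] by (elim disjE; simp)+
  have "spot n = a n + e n * past n + e (Suc n) * tail (Suc n)" by (simp add: spot_def growth_def)
  then show "spot n \<le> 4"
    using c three_signs[of n] 1 by argo
qed

definition num :: "nat \<Rightarrow> real" where "num = recurrence a e 1 0"
definition den :: "nat \<Rightarrow> real" where "den = recurrence a e 0 1"
definition xi :: real where "xi = sqrt 2 * tail 0"
definition err :: "nat \<Rightarrow> real" where "err n = num n - den n * xi"

lemma num_den_simps [simp]:
  "num 0 = 1" "num (Suc 0) = 0" "num (Suc (Suc n)) = sqrt 2 * a n * num (Suc n) + e n * num n"
  "den 0 = 0" "den (Suc 0) = 1" "den (Suc (Suc n)) = sqrt 2 * a n * den (Suc n) + e n * den n"
  by (simp_all add: num_def den_def)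

lemma e_square [simp]: "e n * e n = 1" "e n * (e n * x) = x"
  using e_sign[of n] by auto

lemma den_past: "den n = sqrt 2 * past n * den (Suc n)"
proof (induction n)
  case (Suc n)
  have zp: "growth n > 0" using growth_ge[of n] by simp
  have "den (Suc (Suc n)) = sqrt 2 * a n * den (Suc n) + e n * (sqrt 2 * past n * den (Suc n))"
    using Suc by simp
  also have "\<dots> = sqrt 2 * growth n * den (Suc n)" by (simp add: growth_def algebra_simps)
  finally have 1: "den (Suc (Suc n)) = sqrt 2 * growth n * den (Suc n)" .
  have "past (Suc n) = 1 / (2 * growth n)" by (simp add: growth_def)
  then have "sqrt 2 * past (Suc n) * den (Suc (Suc n)) = (sqrt 2 * sqrt 2) * den (Suc n) / 2"
    using zp by (simp only: 1) (simp add: field_simps)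
  then show ?case by simp
qed simp

lemma den_step: "den (Suc (Suc n)) = sqrt 2 * growth n * den (Suc n)"
  using den_past[of n] by (simp add: growth_def algebra_simps)

lemma sqrt2_bounds: "1414/1000 \<le> sqrt 2" "sqrt 2 \<le> 1415/1000"
proof -
  show "1414/1000 \<le> sqrt 2" by (rule real_le_rsqrt) (simp add: power2_eq_square)
  show "sqrt 2 \<le> 1415/1000" by (rule real_le_lsqrt) (simp_all add: power2_eq_square)
qed

text \<open>A single step can decrease the denominator slightly, but only at a digit 1 with sign \<open>-\<close> before
  it. Then the previous digit was at least 2, and the larger growth there pays for the loss; this
  surplus is what the second conjunct carries along.\<close>

lemma den_growth:
  "2/3 * (6/5)^n \<le> den (Suc n) \<and> (a n = 1 \<and> e n = -1 \<longrightarrow> (6/5)^n \<le> den (Suc n))"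
proof (induction n)
  case (Suc n)
  define g :: real where "g = (6/5)^n"
  have g: "0 < g" by (simp add: g_def)
  have den: "2/3 * g \<le> den (Suc n)" "a n = 1 \<and> e n = -1 \<Longrightarrow> g \<le> den (Suc n)" using Suc by (auto simp: g_def)
  have mul: "14/10 * (u * v) \<le> den (Suc (Suc n))" if "0 \<le> u" "u \<le> growth n" "0 \<le> v" "v \<le> den (Suc n)" for u v
  proof -
    have "14/10 * (u * v) \<le> sqrt 2 * (growth n * den (Suc n))"
      using that sqrt2_bounds by (intro mult_mono) auto
    then show ?thesis by (simp only: den_step mult.assoc)
  qed
  show ?case
  proof (cases "a n = 1 \<and> e n = -1")
    case True
    then have "e (Suc n) = 1" using one_signs[of n] e_sign[of "Suc n"] by blast
    have "2/3 * (6/5 * g) \<le> den (Suc (Suc n))"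
      using mul[of "2/3" g] den(2)[OF True] growth_ge[of n] g by linarith
    then show ?thesis using \<open>e (Suc n) = 1\<close> by (simp add: g_def)
  next
    case False
    then have z1: "1 \<le> growth n" using growth_low[of n] by fastforce
    have "2/3 * (6/5 * g) \<le> den (Suc (Suc n))" using mul[of 1 "2/3 * g"] z1 den(1) g by linarith
    moreover have "6/5 * g \<le> den (Suc (Suc n))" if "a (Suc n) = 1" "e (Suc n) = -1"
    proof -
      have "3/2 \<le> growth n" using ones[OF that(2)] that(1) growth_ge'(1)[of n] a_cases(1)[of n] by blast
      then show ?thesis using mul[of "3/2" "2/3 * g"] den(1) g by linarith
    qed
    ultimately show ?thesis by (simp add: g_def)
  qed
qed simp

lemma den_pos: "0 < den (Suc n)"
proof -
  have "0 < 2/3 * (6/5::real)^n" by simp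
  then show ?thesis using den_growth[of n] by linarith
qed

lemma den_unbounded: "\<exists>n. B < den (Suc n)"
proof -
  obtain n where "B / (2/3) < (6/5::real)^n" using real_arch_pow[of "6/5" "B / (2/3)"] by auto
  then have "B < 2/3 * (6/5)^n" by simp
  then show ?thesis using den_growth[of n] by (intro exI[of _ n]) linarith
qed

lemma den_tendsto: "filterlim (\<lambda>n. den (Suc n)) at_top sequentially"
proof (rule filterlim_at_top_mono[where f = "\<lambda>n. 2/3 * (6/5::real)^n"])
  have "filterlim (\<lambda>n. (6/5::real)^n) at_top sequentially"
    by (rule filterlim_at_infinity_imp_filterlim_at_top[OF filterlim_realpow_sequentially_gt1])
      (auto intro!: always_eventually)
  then show "filterlim (\<lambda>n. 2/3 * (6/5::real)^n) at_top sequentially"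
    by (intro filterlim_tendsto_pos_mult_at_top[OF tendsto_const]) auto
qed (use den_growth in auto)

text \<open>The errors shrink by the tails: the ratio of consecutive errors satisfies the same
  recursion as the tails.\<close>

lemma err_step: "err (Suc n) = - e n * (sqrt 2 * tail n) * err n"
proof (induction n)
  case 0
  then show ?case by (simp add: err_def xi_def e_0)
next
  case (Suc n)
  have t0: "tail n > 0" by (rule tail_pos)
  note y = tail_inverse[of n]
  have spot: "err n = - e n * err (Suc n) / (sqrt 2 * tail n)"
    using Suc t0 e_sign[of n] by (auto simp: field_simps)
  have "err (Suc (Suc n)) = sqrt 2 * a n * err (Suc n) + e n * err n"
    by (simp add: err_def algebra_simps)
  also have "\<dots> = sqrt 2 * a n * err (Suc n) - err (Suc n) / (sqrt 2 * tail n)"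
    unfolding spot by simp
  also have "\<dots> = err (Suc n) * (sqrt 2 * a n - sqrt 2 * (1 / (2 * tail n)))"
    using t0 by (simp add: field_simps)
  also have "\<dots> = - e (Suc n) * (sqrt 2 * tail (Suc n)) * err (Suc n)"
    unfolding y by (simp add: algebra_simps)
  finally show ?case .
qed

lemma determinant: "\<bar>num n * den (Suc n) - num (Suc n) * den n\<bar> = 1"
proof (induction n)
  case (Suc n)
  have "num (Suc n) * den (Suc (Suc n)) - num (Suc (Suc n)) * den (Suc n)
     = - e n * (num n * den (Suc n) - num (Suc n) * den n)" by (simp add: algebra_simps)
  then show ?case using Suc e_sign[of n] by (auto simp: abs_mult)
qed simp

text \<open>Expressing both \<open>den n\<close> and \<open>err n\<close> by their successors turns the determinant of two
  consecutive convergents, which is \<open>1\<close> or \<open>- 1\<close>, into the form at one of them.\<close>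

lemma spot_value: "den (Suc n) * \<bar>err (Suc n)\<bar> * (sqrt 2 * spot n) = 1"
proof -
  have t0: "tail n > 0" by (rule tail_pos)
  note y = tail_inverse[of n]
  have spot: "err n = - e n * err (Suc n) / (sqrt 2 * tail n)"
    using err_step[of n] t0 e_sign[of n] by (auto simp: field_simps)
  have "1 = \<bar>den (Suc n) * err n - den n * err (Suc n)\<bar>"
    using determinant[of n] by (simp add: err_def algebra_simps)
  also have "den (Suc n) * err n - den n * err (Suc n) =
     - e n * (den (Suc n) * err (Suc n)) * (sqrt 2 * (1 / (2 * tail n)) + sqrt 2 * (e n * past n))"
    unfolding spot using t0 by (subst den_past) (simp add: field_simps)
  also have "\<dots> = - e n * (den (Suc n) * err (Suc n)) * (sqrt 2 * spot n)"
    unfolding y by (simp add: spot_def growth_def algebra_simps)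
  also have "\<bar>\<dots>\<bar> = den (Suc n) * \<bar>err (Suc n)\<bar> * (sqrt 2 * spot n)"
    using den_pos[of n] spot_pos[of n] e_sign[of n] by (auto simp: abs_mult)
  finally show ?thesis by simp
qed

text \<open>The matrix of consecutive convergents has determinant \<open>1\<close> or \<open>- 1\<close>; the sign \<open>\<omega>\<close> repairs it.
  One step of the recurrence is then right multiplication by a power of the translation times
  the inversion, up to sign.\<close>

lemma spot_matrix:
  "\<exists>\<omega>. (\<omega> = 1 \<or> \<omega> = -1) \<and> mat2 (num (Suc n)) (\<omega> * num n) (den (Suc n)) (\<omega> * den n) \<in> H4_mat"
proof (induction n)
  case 0
  then show ?case using H4_mat_S by (intro exI[of _ "-1"]) (simp add: S_mat_mat2)
next
  case (Suc n)
  then obtain \<omega> where w: "\<omega> = 1 \<or> \<omega> = -1"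
    and M: "mat2 (num (Suc n)) (\<omega> * num n) (den (Suc n)) (\<omega> * den n) \<in> H4_mat" by blast
  obtain k :: int where k: "a n = of_int k" using a_int[of n] by (auto elim: Ints_cases)
  define \<omega>' where "\<omega>' = - e n * \<omega>"
  have w': "\<omega>' = 1 \<or> \<omega>' = -1" using w e_sign[of n] by (auto simp: \<omega>'_def)
  have T: "mat2 (of_int j * sqrt 2) (-1) 1 0 \<in> H4_mat" for j
    using H4_mat_mult[OF H4_mat_translation[of j] H4_mat_S] by (simp add: S_mat_mat2 mat2_mult)
  have "mat2 (sqrt 2 * a n) \<omega>' (- \<omega>') 0 \<in> H4_mat"
    using w'
  proof
    assume "\<omega>' = 1"
    then show ?thesis using H4_mat_uminus[OF T[of "- k"]] by (simp add: mat2_uminus k mult.commute)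
  next
    assume "\<omega>' = -1"
    then show ?thesis using T[of k] by (simp add: k mult.commute)
  qed
  from H4_mat_mult[OF M this]
  have "mat2 (num (Suc (Suc n))) (\<omega>' * num (Suc n)) (den (Suc (Suc n))) (\<omega>' * den (Suc n)) \<in> H4_mat"
    using w by (auto simp: mat2_mult \<omega>'_def algebra_simps)
  then show ?case using w' by blast
qed

lemma spot_in_H4:
  obtains M where "M \<in> H4_mat" "M$1$1 = num (Suc n)" "M$2$1 = den (Suc n)"
  using spot_matrix[of n] by (metis mat2_entries(1) mat2_entries(3))

end

section \<open>The Lagrange value of a signed continued fraction\<close>

text \<open>The left side is convex in \<open>x\<close>, so the ends of the window suffice.\<close>

lemma spot_window:
  fixes x growth spot :: real
  assumes "1/5 \<le> x" "x \<le> growth/3" "2/3 \<le> growth" "2/3 * growth \<le> spot" "growth < 1 \<Longrightarrow> growth \<le> spot"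
  shows "x / spot + 1 / (8 * x) \<le> 1"
proof -
  define f where "f y = y\<^sup>2 - spot * y + spot/8" for y :: real
  have spot: "2/3 \<le> spot" using assms by linarith
  have f1: "f (1/5) \<le> 0" using spot by (simp add: f_def power2_eq_square)
  have f2: "f (growth/3) \<le> 0"
  proof (cases "growth < 1")
    case True
    have "growth * (growth/3 - 1/8) \<le> spot * (growth/3 - 1/8)" using assms True by (intro mult_right_mono) auto
    moreover have "0 \<le> growth * (2/9 * growth - 1/8)" using assms by (intro mult_nonneg_nonneg) auto
    ultimately show ?thesis by (simp add: f_def power2_eq_square algebra_simps)
  next
    case False
    have "2/3 * growth * (growth/3 - 1/8) \<le> spot * (growth/3 - 1/8)" using assms False by (intro mult_right_mono) auto
    moreover have "0 \<le> growth * (1/9 * growth - 1/12)" using False by (intro mult_nonneg_nonneg) auto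
    ultimately show ?thesis by (simp add: f_def power2_eq_square algebra_simps)
  qed
  have pos: "0 < growth/3 - 1/5" using assms by simp
  have "f x * (v - u) = (v - x) * f u + (x - u) * f v - (x - u) * (v - x) * (v - u)" for u v
    unfolding f_def power2_eq_square by (simp add: field_simps)
  then have "f x * (growth/3 - 1/5) = (growth/3 - x) * f (1/5) + (x - 1/5) * f (growth/3)
      - (x - 1/5) * (growth/3 - x) * (growth/3 - 1/5)" .
  also have "\<dots> \<le> 0"
    using mult_nonneg_nonpos[of "growth/3 - x" "f (1/5)"] mult_nonneg_nonpos[of "x - 1/5" "f (growth/3)"]
      mult_nonneg_nonneg[of "(x - 1/5) * (growth/3 - x)" "growth/3 - 1/5"] mult_nonneg_nonneg[of "x - 1/5" "growth/3 - x"]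
      f1 f2 assms pos by linarith
  finally have "f x \<le> 0" using pos by (simp add: mult_le_0_iff)
  then have "8 * x\<^sup>2 + spot \<le> 8 * x * spot" by (simp add: f_def algebra_simps)
  moreover have "x / spot + 1 / (8 * x) = (8 * x\<^sup>2 + spot) / (8 * x * spot)"
    using assms spot by (simp add: field_simps power2_eq_square)
  ultimately show ?thesis using assms spot by simp
qed

context digits
begin

text \<open>The analogue of Legendre's theorem. Pick the index at which the denominators pass \<open>3 * r\<close>. If
  \<open>(p, q)\<close> were not that convergent, the determinant of the two columns would be at least 1; but
  it is at most \<open>den * \<bar>p - q * \<xi>\<bar> + r * \<bar>err\<bar>\<close>, which with \<open>r = sqrt 2 * x * den\<close> is less
  than the quantity bounded in \<open>spot_window\<close>. The factor 3 balances the two ends of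
  that window.\<close>

lemma small_form_is_convergent:
  assumes M: "M \<in> H4_mat" and q: "M$2$1 \<noteq> 0"
    and small: "\<bar>M$2$1\<bar> * \<bar>M$1$1 - M$2$1 * xi\<bar> < 1 / (4 * sqrt 2)"
  shows "\<exists>n. M$1$1 = num (Suc n) \<and> M$2$1 = den (Suc n) \<or> M$1$1 = - num (Suc n) \<and> M$2$1 = - den (Suc n)"
proof -
  define p q where "p = M$1$1" "q = M$2$1"
  define r where "r = \<bar>q\<bar>"
  have r: "1 \<le> r" using hecke_lower_left[OF H4_mat_hecke[OF M]] q by (auto simp: r_def p_q_def)
  define n where "n = (LEAST n. 3 * r < den (Suc (Suc n)))"
  obtain k where k: "3 * r < den (Suc k)" using den_unbounded by blast
  have "k \<noteq> 0"
  proof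
    assume "k = 0"
    then show False using k r by simp
  qed
  then obtain j where "k = Suc j" by (cases k) auto
  with k have "3 * r < den (Suc (Suc j))" by simp
  then have up: "3 * r < den (Suc (Suc n))" unfolding n_def by (rule LeastI)
  have low: "den (Suc n) \<le> 3 * r"
  proof (cases n)
    case 0
    then show ?thesis using r by simp
  next
    case (Suc j)
    then have "\<not> 3 * r < den (Suc (Suc j))" unfolding n_def by (intro not_less_Least) simp
    then show ?thesis using Suc by simp
  qed
  have den: "0 < den (Suc n)" by (rule den_pos)
  define x where "x = r / (sqrt 2 * den (Suc n))"
  have rx: "r = sqrt 2 * x * den (Suc n)" using den by (simp add: x_def)
  have "den (Suc n) * (1/5) \<le> den (Suc n) * x"
  proof -
    have "den (Suc n) * 1 \<le> den (Suc n) * x * (3 * sqrt 2)" using low by (simp add: rx algebra_simps)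
    moreover have "den (Suc n) * x * (3 * sqrt 2) \<le> den (Suc n) * x * 5"
      using r den sqrt2_bounds by (intro mult_left_mono) (auto simp: x_def)
    ultimately show ?thesis by simp
  qed
  then have x1: "1/5 \<le> x" using den by (simp only: mult_le_cancel_left_pos)
  have "(sqrt 2 * den (Suc n)) * x \<le> (sqrt 2 * den (Suc n)) * (growth n / 3)"
    using up by (simp only: den_step rx) (simp add: algebra_simps)
  moreover have "0 < sqrt 2 * den (Suc n)" using den by simp
  ultimately have x2: "x \<le> growth n / 3" by (simp only: mult_le_cancel_left_pos)
  have spot: "0 < spot n" by (rule spot_pos)
  have window: "x / spot n + 1 / (8 * x) \<le> 1"
    by (rule spot_window[OF x1 x2 growth_ge spot_ge spot_ge'])
  have "\<bar>err (Suc n)\<bar> = 1 / (den (Suc n) * (sqrt 2 * spot n))"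
    using spot_value[of n] den spot by (simp add: field_simps)
  then have A: "r * \<bar>err (Suc n)\<bar> = x / spot n" using den spot by (simp add: rx)
  have "\<bar>p - q * xi\<bar> * r < 1 / (4 * sqrt 2)"
    using small by (simp only: p_q_def r_def mult.commute)
  then have "\<bar>p - q * xi\<bar> < 1 / (4 * sqrt 2) / r"
    using r by (subst pos_less_divide_eq) linarith+
  also have "\<dots> = 1 / (8 * x) / den (Suc n)" using den x1 by (simp add: rx)
  finally have B: "den (Suc n) * \<bar>p - q * xi\<bar> < 1 / (8 * x)"
    using den by (simp only: pos_less_divide_eq mult.commute)
  obtain N where N: "N \<in> H4_mat" "N$1$1 = num (Suc n)" "N$2$1 = den (Suc n)" by (rule spot_in_H4)
  have "p * den (Suc n) - q * num (Suc n) = den (Suc n) * (p - q * xi) - q * err (Suc n)"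
    by (simp add: err_def algebra_simps)
  then have "\<bar>p * den (Suc n) - q * num (Suc n)\<bar> \<le> \<bar>den (Suc n) * (p - q * xi)\<bar> + \<bar>q * err (Suc n)\<bar>"
    by linarith
  also have "\<dots> = den (Suc n) * \<bar>p - q * xi\<bar> + r * \<bar>err (Suc n)\<bar>"
    using den by (simp add: abs_mult r_def)
  also have "\<dots> < 1" using A B window by linarith
  finally show ?thesis
    using H4_first_columns[OF M N(1)] unfolding N p_q_def by (intro exI[of _ n]) fastforce
qed

lemma spot_value_inverse: "den (Suc n) * \<bar>num (Suc n) - den (Suc n) * xi\<bar> = 1 / (sqrt 2 * spot n)"
  using spot_value[of n] spot_pos[of n] by (simp add: err_def field_simps)

text \<open>Otherwise the errors would be multiples of a fixed positive number, while they tend to 0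
  without vanishing.\<close>

lemma xi_irrational: "xi \<notin> sqrt2_rationals"
proof
  assume "xi \<in> sqrt2_rationals"
  then obtain y where y: "y \<in> \<rat>" "xi = sqrt 2 * y" by (auto simp: sqrt2_rationals_def)
  obtain u v :: int where uv: "v > 0" "y = of_int u / of_int v" using y(1) by (rule Rats_cases') 
  obtain n where n: "2 * of_int v < den (Suc n)" using den_unbounded by blast
  obtain N where N: "N \<in> H4_mat" "N$1$1 = num (Suc n)" "N$2$1 = den (Suc n)" by (rule spot_in_H4)
  have big: "1 \<le> \<bar>of_int i :: real\<bar>" if "of_int i \<noteq> (0::real)" for i :: int using that by simp
  have s: "sqrt 2 * (sqrt 2 * x) = 2 * x" for x :: real by (simp add: mult.assoc[symmetric])
  have dn: "4/9 \<le> spot n" using spot_ge[of n] growth_ge[of n] by linarith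
  have "14/10 * (4/9) \<le> sqrt 2 * spot n" using dn sqrt2_bounds by (intro mult_mono) auto
  then have "1 / (sqrt 2 * spot n) \<le> 1 / (1/2)" by (intro divide_left_mono) auto
  then have up: "den (Suc n) * \<bar>err (Suc n)\<bar> \<le> 2" using spot_value_inverse[of n] by (simp add: err_def)
  have nz: "err (Suc n) \<noteq> 0" using spot_value[of n] by auto
  have "1 \<le> of_int v * \<bar>err (Suc n)\<bar>"
  proof -
    from H4_mat_hecke[OF N(1)] consider
        (even) a c :: int where "num (Suc n) = of_int a" "den (Suc n) = of_int c * sqrt 2"
      | (odd) a c :: int where "num (Suc n) = of_int a * sqrt 2" "den (Suc n) = of_int c"
      unfolding hecke_form_def N(2,3)[symmetric] by (auto)
    then show ?thesis
    proof cases
      case even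
      have "of_int v * err (Suc n) = of_int (a * v - 2 * c * u)"
        using uv by (simp add: err_def even y(2) field_simps s)
      moreover have "of_int v * err (Suc n) \<noteq> 0" using uv nz by simp
      ultimately have "1 \<le> \<bar>of_int v * err (Suc n)\<bar>" using big by metis
      then show ?thesis using uv by (simp add: abs_mult)
    next
      case odd
      have eq: "of_int v * err (Suc n) = sqrt 2 * of_int (a * v - c * u)"
        using uv by (simp add: err_def odd y(2) field_simps)
      moreover have "of_int v * err (Suc n) \<noteq> 0" using uv nz by simp
      ultimately have nz': "of_int (a * v - c * u) \<noteq> (0::real)" by (metis mult_zero_right)
      then have "1 * 1 \<le> sqrt 2 * \<bar>of_int (a * v - c * u) :: real\<bar>"
        using big[OF nz'] by (intro mult_mono) auto
      then have "1 \<le> \<bar>of_int v * err (Suc n)\<bar>" unfolding eq by (simp add: abs_mult)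
      then show ?thesis using uv by (simp add: abs_mult)
    qed
  qed
  moreover have pos: "0 < \<bar>err (Suc n)\<bar>" using nz by simp
  then have "2 * (of_int v * \<bar>err (Suc n)\<bar>) < den (Suc n) * \<bar>err (Suc n)\<bar>"
    using mult_strict_right_mono[OF n pos] by (simp only: mult.assoc)
  ultimately show False using up by linarith
qed

lemma same_spot:
  assumes "num (Suc n) / den (Suc n) = num (Suc k) / den (Suc k)"
  shows "den (Suc n) = den (Suc k)"
proof -
  obtain M where M: "M \<in> H4_mat" "M$1$1 = num (Suc n)" "M$2$1 = den (Suc n)" by (rule spot_in_H4)
  obtain N where N: "N \<in> H4_mat" "N$1$1 = num (Suc k)" "N$2$1 = den (Suc k)" by (rule spot_in_H4)
  have pos: "0 < den (Suc n)" "0 < den (Suc k)" by (rule den_pos)+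
  then have "num (Suc n) * den (Suc k) - den (Suc n) * num (Suc k) = 0" using assms by (simp add: field_simps)
  then show ?thesis using H4_first_columns[OF M(1) N(1)] pos unfolding M N by auto
qed

text \<open>Above the threshold \<open>4 * sqrt 2\<close> only convergents matter, so the Lagrange value is the limit
  superior of the spot values.\<close>

lemma Lagrange_value_xi:
  assumes m: "4 * sqrt 2 \<le> m"
    and above: "\<And>L. m < L \<Longrightarrow> finite {n. L < sqrt 2 * spot n}"
    and below: "\<And>L. L < m \<Longrightarrow> infinite {n. L < sqrt 2 * spot n}"
  shows "Lagrange_value xi = ereal m"
proof -
  define pt where "pt n = Fin (num (Suc n) / den (Suc n))" for n
  have m0: "0 < m" using m sqrt2_bounds by linarith
  have val: "den (Suc n) * \<bar>num (Suc n) - den (Suc n) * xi\<bar> < 1 / L \<longleftrightarrow> L < sqrt 2 * spot n" if "0 < L" for n L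
  proof -
    have "1 / D < 1 / L \<longleftrightarrow> L < D" if "0 < D" for D :: real
      using that \<open>0 < L\<close> by (simp add: field_simps)
    from this[of "sqrt 2 * spot n"] show ?thesis unfolding spot_value_inverse using spot_pos[of n] by simp
  qed
  have fin: "finite (good_points xi L)" if L: "m < L" for L
  proof (rule finite_subset[OF _ finite_imageI[OF above[OF L], of pt]], rule subsetI)
    fix x assume "x \<in> good_points xi L"
    then obtain M where M: "M \<in> H4_mat" "M$2$1 \<noteq> 0" "x = moebius M Infty"
      and s: "\<bar>xi - M$1$1 / M$2$1\<bar> < 1 / (L * (M$2$1)\<^sup>2)" by (auto simp: good_points_def)
    have L0: "0 < L" using m0 L by simp
    have s: "\<bar>M$2$1\<bar> * \<bar>M$1$1 - M$2$1 * xi\<bar> < 1 / L" using s good_point_iff[OF M(2) L0] by blast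
    also have "1 / L \<le> 1 / (4 * sqrt 2)" using L m L0 by (intro divide_left_mono) auto
    finally obtain n where n: "M$1$1 = num (Suc n) \<and> M$2$1 = den (Suc n) \<or> M$1$1 = - num (Suc n) \<and> M$2$1 = - den (Suc n)"
      using small_form_is_convergent[OF M(1,2)] by blast
    then have "den (Suc n) * \<bar>num (Suc n) - den (Suc n) * xi\<bar> < 1 / L"
      using s den_pos[of n] by (auto simp: abs_minus_commute)
    then have "L < sqrt 2 * spot n" using val[OF L0] by simp
    moreover have "x = pt n" using n M(2,3) by (auto simp: pt_def)
    ultimately show "x \<in> pt ` {n. L < sqrt 2 * spot n}" by blast
  qed
  have inf: "infinite (good_points xi L)" if L: "0 < L" "L < m" for L
  proof
    assume f: "finite (good_points xi L)"
    have "pt ` {n. L < sqrt 2 * spot n} \<subseteq> good_points xi L"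
    proof
      fix x assume "x \<in> pt ` {n. L < sqrt 2 * spot n}"
      then obtain n where n: "x = pt n" "L < sqrt 2 * spot n" by blast
      obtain N where N: "N \<in> H4_mat" "N$1$1 = num (Suc n)" "N$2$1 = den (Suc n)" by (rule spot_in_H4)
      have den: "0 < den (Suc n)" by (rule den_pos)
      have "den (Suc n) * \<bar>num (Suc n) - den (Suc n) * xi\<bar> < 1 / L" using val[OF L(1)] n(2) by simp
      then have "\<bar>xi - num (Suc n) / den (Suc n)\<bar> < 1 / (L * (den (Suc n))\<^sup>2)"
        using good_point_iff[of "den (Suc n)" L xi "num (Suc n)"] den L by simp
      moreover have "moebius N Infty = x" using N den n by (simp add: pt_def)
      ultimately show "x \<in> good_points xi L" unfolding good_points_def using N den by force
    qed
    then have "finite (pt ` {n. L < sqrt 2 * spot n})" using f finite_subset by blast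
    from pigeonhole_infinite[OF below[OF L(2)] this]
    obtain n0 where n0: "infinite {n \<in> {n. L < sqrt 2 * spot n}. pt n = pt n0}" by blast
    have "eventually (\<lambda>n. den (Suc n0) + 1 \<le> den (Suc n)) sequentially"
      using den_tendsto by (simp only: filterlim_at_top)
    then have "finite {n. \<not> den (Suc n0) + 1 \<le> den (Suc n)}"
      by (simp add: eventually_cofinite cofinite_eq_sequentially[symmetric])
    moreover have "{n \<in> {n. L < sqrt 2 * spot n}. pt n = pt n0} \<subseteq> {n. \<not> den (Suc n0) + 1 \<le> den (Suc n)}"
      using same_spot[of _ n0] by (force simp: pt_def)
    ultimately show False using n0 finite_subset by blast
  qed
  show ?thesis unfolding Lagrange_value_def
  proof (rule antisym)
    show "Sup {ereal L |L. 0 < L \<and> infinite (good_points xi L)} \<le> ereal m"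
      using fin by (intro Sup_least) (force simp: not_less[symmetric])
    show "ereal m \<le> Sup {ereal L |L. 0 < L \<and> infinite (good_points xi L)}"
    proof (rule dense_le)
      fix w assume "w < ereal m"
      then obtain L where L: "w < ereal L" "L < m" using ereal_dense2[of w "ereal m"] by auto
      have "ereal (max L (m/2)) \<le> Sup {ereal L |L. 0 < L \<and> infinite (good_points xi L)}"
      proof (intro Sup_upper CollectI exI conjI)
        show "infinite (good_points xi (max L (m/2)))" using L m0 by (intro inf) auto
      qed (use m0 in auto)
      then show "w \<le> Sup {ereal L |L. 0 < L \<and> infinite (good_points xi L)}"
        using L(1) by (meson dual_order.trans less_imp_le ereal_less_eq(3) max.cobounded1)
    qed
  qed
qed

end

section \<open>A digit sequence for every value on the ray\<close>

lemma concat_blocks: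
  assumes "\<And>k. B k \<noteq> ([] :: 'a list)"
  shows "\<exists>(s :: nat \<Rightarrow> 'a) st. st 0 = 0 \<and> (\<forall>k. st (Suc k) = st k + length (B k)) \<and>
    (\<forall>k i. i < length (B k) \<longrightarrow> s (st k + i) = B k ! i)"
proof -
  define c where "c k = concat (map B [0..<k])" for k
  define s where "s n = c (Suc n) ! n" for n
  define st where "st k = length (c k)" for k
  have c_Suc: "c (Suc k) = c k @ B k" for k by (simp add: c_def)
  have len: "k \<le> length (c k)" for k
  proof (induction k)
    case (Suc k)
    have "0 < length (B k)" using assms by simp
    then show ?case using Suc by (simp only: c_Suc length_append)
  qed simp
  have pre: "n < length (c k) \<and> c (k + j) ! n = c k ! n" if "n < length (c k)" for k j n
  proof (induction j)
    case (Suc j)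
    have "length (c k) \<le> length (c (k + j))" by (induction j) (auto simp: c_Suc)
    then show ?case using Suc that by (simp add: c_Suc nth_append)
  qed (use that in simp)
  have "s (st k + i) = B k ! i" if "i < length (B k)" for k i
  proof -
    define p where "p = st k + i"
    have p: "p < length (c (Suc k))" "p < length (c (Suc p))"
      using that len[of "Suc p"] by (auto simp: p_def st_def c_Suc)
    have "c (Suc p) ! p = c (Suc p + Suc k) ! p" using pre[OF p(2), of "Suc k"] by simp
    also have "\<dots> = c (Suc k) ! p" using pre[OF p(1), of "Suc p"] by (simp add: add.commute)
    also have "\<dots> = B k ! i" by (simp add: c_Suc p_def st_def)
    finally show ?thesis by (simp add: s_def p_def)
  qed
  moreover have "st 0 = 0" "\<And>k. st (Suc k) = st k + length (B k)"
    by (simp_all add: st_def c_Suc) (simp add: c_def)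
  ultimately show ?thesis by blast
qed

lemma block_index:
  fixes st :: "nat \<Rightarrow> nat"
  assumes "st 0 = 0" "\<And>k. st (Suc k) = st k + len k" "\<And>k. 0 < len k"
  shows "\<exists>k i. n = st k + i \<and> i < len k"
proof -
  have "k \<le> st k" for k
  proof (induction k)
    case (Suc k)
    then show ?case using assms(2,3)[of k] by simp
  qed simp
  then have "n < st (Suc n)" using less_eq_Suc_le by blast
  define k where "k = (LEAST k. n < st (Suc k))"
  have up: "n < st (Suc k)" unfolding k_def using \<open>n < st (Suc n)\<close> by (rule LeastI)
  have "st k \<le> n"
  proof (cases k)
    case 0
    then show ?thesis using assms by simp
  next
    case (Suc j)
    then have "\<not> n < st (Suc j)" unfolding k_def by (intro not_less_Least) simp
    then show ?thesis using Suc by simp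
  qed
  then show ?thesis using up assms(2)[of k] by (intro exI[of _ k] exI[of _ "n - st k"]) simp
qed

text \<open>The fraction of a word with its outermost letter first.\<close>

fun cfrac :: "(real \<times> real) list \<Rightarrow> real \<Rightarrow> real" where
  "cfrac [] y = 1 / (2 * y)"
| "cfrac ((a, e) # w) y = 1 / (2 * (a + e * cfrac w y))"

lemma cfrac_snoc: "cfrac (w @ [(a, e)]) y = cfrac w (a + e / (2 * y))"
  by (induction w) (auto simp: split_paired_all)

lemma cyl_cfrac: "set w \<subseteq> letters \<Longrightarrow> y \<ge> 1 \<Longrightarrow> cyl w y = cfrac (rev w) y"
proof (induction w arbitrary: y)
  case (Cons l w)
  obtain a e where l: "l = (a, e)" by fastforce
  have le: "(a, e) \<in> letters" and w: "set w \<subseteq> letters" using Cons l by auto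
  define r where "r = 1 / (2 * y)"
  have "0 < r" "r \<le> 1/2" using Cons(3) by (auto simp: r_def field_simps)
  then have "1 \<le> a + e * r" using le by (auto simp: letters_def)
  then have "1 \<le> a + e / (2 * y)" by (simp add: r_def)
  then show ?case using Cons w le by (simp add: l cyl_Cons cfrac_snoc)
qed (simp add: cyl_Nil)

text \<open>Conversion of a word into digits with preceding signs: a letter of a word carries the sign that
  follows its digit, whereas the digit sequence carries the sign that precedes it. The word is
  closed by a digit 2, which no sign rule concerns and whose continuation lies in the interval of
  type 0.\<close>

fun outward :: "real \<Rightarrow> (real \<times> real) list \<Rightarrow> (real \<times> real) list" where
  "outward s [] = [(s, 2)]"
| "outward s ((a, e) # w) = (s, a) # outward e w"

context digits
begin

lemma tail_two: "a n = 2 \<Longrightarrow> 59/50 \<le> a n + e (Suc n) * tail (Suc n) \<and> a n + e (Suc n) * tail (Suc n) \<le> 141/50"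
  using tail_bounds[of "Suc n"] tail_pos[of "Suc n"] tail_sup_bounds(2)[of "Suc n"] e_sign[of "Suc n"] by auto

lemma past_two: "a n = 2 \<Longrightarrow> 59/50 \<le> a n + e n * past n \<and> a n + e n * past n \<le> 141/50"
  using past_bounds[of n] e_sign[of n] by auto

lemma tail_outward:
  assumes "\<And>i. i < length (outward s w) \<Longrightarrow> (e (n + i), a (n + i)) = outward s w ! i"
  shows "\<exists>y. 59/50 \<le> y \<and> y \<le> 141/50 \<and> tail n = cfrac w y"
  using assms
proof (induction w arbitrary: s n)
  case Nil
  have "a n = 2" using Nil[of 0] by simp
  then show ?case using tail_two[of n] tail_step[of n] by (intro exI[of _ "a n + e (Suc n) * tail (Suc n)"]) simp
next
  case (Cons l w)
  obtain x f where l: "l = (x, f)" by fastforce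
  have "(e (Suc n + i), a (Suc n + i)) = outward f w ! i" if "i < length (outward f w)" for i
    using Cons(2)[of "Suc i"] that by (simp add: l)
  from Cons(1)[OF this] obtain y where y: "59/50 \<le> y" "y \<le> 141/50" "tail (Suc n) = cfrac w y" by blast
  have "a n = x" using Cons(2)[of 0] by (simp add: l)
  moreover have "e (Suc n) = f"
  proof -
    have "length (outward f w) > 0" "fst (outward f w ! 0) = f" by (cases w; auto simp: split_paired_all)+
    then show ?thesis using Cons(2)[of 1] by (simp add: l) (metis fst_conv)
  qed
  ultimately have "tail n = cfrac (l # w) y" using tail_step[of n] y(3) by (simp add: l)
  then show ?case using y by blast
qed

lemma past_inward:
  assumes "a n = 2" "\<And>i. i < length v \<Longrightarrow> (a (Suc n + i), e (Suc n + i)) = v ! i"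
  shows "past (Suc n + length v) = cfrac (rev v) (a n + e n * past n)"
  using assms(2)
proof (induction v rule: rev_induct)
  case (snoc l v)
  have "(a (Suc n + i), e (Suc n + i)) = v ! i" if "i < length v" for i
    using snoc(2)[of i] that by (simp add: nth_append)
  then have IH: "past (Suc n + length v) = cfrac (rev v) (a n + e n * past n)" using snoc(1) by blast
  have l: "l = (a (Suc n + length v), e (Suc n + length v))" using snoc(2)[of "length v"] by simp
  show ?case using IH by (simp add: l)
qed simp

end

text \<open>The sign rules of the locale \<open>digits\<close> as a relation between consecutive pairs of sign and digit.\<close>

definition compatible :: "real \<times> real \<Rightarrow> real \<times> real \<Rightarrow> bool" where
  "compatible = (\<lambda>(e, a) (e', a'). (e' = -1 \<longrightarrow> \<not> (a = 1 \<and> a' = 1)) \<and> \<not> (a = 1 \<and> e = -1 \<and> e' = -1)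
     \<and> (a = 3 \<longrightarrow> e = -1 \<or> e' = -1))"

text \<open>Read from the central digit \<open>c\<close> to the left, the letters of \<open>w'\<close> occur with the sign pointing
  away from the centre, so swapping the components suffices; to the right the signs have to be
  shifted. The digit 2 at either end separates the block from its neighbours.\<close>

definition block :: "(real \<times> real) list \<Rightarrow> real \<Rightarrow> real \<Rightarrow> real \<Rightarrow> (real \<times> real) list \<Rightarrow> (real \<times> real) list" where
  "block w' \<tau> c \<sigma> w = (1, 2) # map prod.swap w' @ (\<tau>, c) # outward \<sigma> (rev w)"

lemma outward_props:
  assumes "set w \<subseteq> letters" "s = 1 \<or> s = -1"
  shows "successively compatible (outward s w)" "outward s w \<noteq> []" "fst (hd (outward s w)) = s" "snd (last (outward s w)) = 2"
    "\<And>x. x \<in> set (outward s w) \<Longrightarrow> (fst x = 1 \<or> fst x = -1) \<and> (snd x = 1 \<or> snd x = 2 \<or> snd x = 3)"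
proof -
  have "successively compatible (outward s w) \<and> outward s w \<noteq> [] \<and> fst (hd (outward s w)) = s \<and> snd (last (outward s w)) = 2 \<and>
    (\<forall>x\<in>set (outward s w). (fst x = 1 \<or> fst x = -1) \<and> (snd x = 1 \<or> snd x = 2 \<or> snd x = 3))"
    using assms
  proof (induction w arbitrary: s)
    case (Cons l w)
    obtain a e where l: "l = (a, e)" "(a, e) \<in> letters" using Cons.prems by (cases l) auto
    have "e = 1 \<or> e = -1" using l(2) by (auto simp: letters_def)
    then have IH: "successively compatible (outward e w)" "outward e w \<noteq> []" "fst (hd (outward e w)) = e"
      "snd (last (outward e w)) = 2"
      "\<forall>x\<in>set (outward e w). (fst x = 1 \<or> fst x = -1) \<and> (snd x = 1 \<or> snd x = 2 \<or> snd x = 3)"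
      using Cons by auto
    obtain a' where h: "hd (outward e w) = (e, a')" using IH(3) by (metis prod.collapse)
    have "compatible (s, a) (hd (outward e w))" unfolding h using l(2) by (auto simp: compatible_def letters_def)
    moreover have "a = 1 \<or> a = 2 \<or> a = 3" using l(2) by (auto simp: letters_def)
    ultimately show ?case using IH Cons.prems by (simp add: l(1) successively_Cons)
  qed auto
  then show "successively compatible (outward s w)" "outward s w \<noteq> []" "fst (hd (outward s w)) = s" "snd (last (outward s w)) = 2"
    "\<And>x. x \<in> set (outward s w) \<Longrightarrow> (fst x = 1 \<or> fst x = -1) \<and> (snd x = 1 \<or> snd x = 2 \<or> snd x = 3)"
    by blast+
qed

lemma inward_compatible:
  assumes "set w \<subseteq> letters" "x = 1 \<or> x = -1" "4 \<le> c"
  shows "successively compatible (map prod.swap w @ [(x, c)])"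
  using assms(1)
proof (induction w)
  case (Cons l w)
  obtain a e where l: "l = (a, e)" "(a, e) \<in> letters" using Cons by (cases l) auto
  show ?case
  proof (cases w)
    case Nil
    then show ?thesis using l assms by (auto simp: compatible_def letters_def)
  next
    case (Cons l' v)
    obtain a' e' where l': "l' = (a', e')" "(a', e') \<in> letters" using Cons Cons.prems by (cases l') auto
    have "compatible (e, a) (e', a')" using l(2) l'(2) by (auto simp: compatible_def letters_def)
    then show ?thesis using Cons.IH Cons.prems Cons l l' by simp
  qed
qed simp

lemma block_props:
  assumes "set w \<subseteq> letters" "set w' \<subseteq> letters" "\<sigma> = 1 \<or> \<sigma> = -1" "\<tau> = 1 \<or> \<tau> = -1" "4 \<le> c" "c \<in> \<int>"
  shows "successively compatible (block w' \<tau> c \<sigma> w)" "snd (last (block w' \<tau> c \<sigma> w)) = 2"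
    "\<And>x. x \<in> set (block w' \<tau> c \<sigma> w) \<Longrightarrow> (fst x = 1 \<or> fst x = -1) \<and> snd x \<in> \<int> \<and> 1 \<le> snd x"
    "\<And>i. i < length (block w' \<tau> c \<sigma> w) \<Longrightarrow> snd (block w' \<tau> c \<sigma> w ! i) \<le> 3 \<or> i = Suc (length w')"
proof -
  have rw: "set (rev w) \<subseteq> letters" using assms by simp
  note f = outward_props[OF rw assms(3)]
  have sw: "(fst x = 1 \<or> fst x = -1) \<and> (snd x = 1 \<or> snd x = 2 \<or> snd x = 3)"
    if "x \<in> set (map prod.swap w')" for x using that assms(2) by (auto simp: letters_def)
  obtain y where y: "hd (outward \<sigma> (rev w)) = (\<sigma>, y)" using f(3) by (metis prod.collapse)
  have 1: "successively compatible (map prod.swap w' @ [(\<tau>, c)])" using inward_compatible assms by blast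
  have "compatible (1, 2) (hd (map prod.swap w' @ [(\<tau>, c)]))" by (auto simp: compatible_def split: prod.split)
  then have 2: "successively compatible ((1, 2) # map prod.swap w' @ [(\<tau>, c)])" using 1 by (simp add: successively_Cons)
  have "compatible (\<tau>, c) (\<sigma>, y)" using assms by (auto simp: compatible_def)
  then have "successively compatible (((1, 2) # map prod.swap w' @ [(\<tau>, c)]) @ outward \<sigma> (rev w))"
    using 2 f(1,2) y by (simp only: successively_append_iff) simp
  then show "successively compatible (block w' \<tau> c \<sigma> w)" by (simp add: block_def)
  show "snd (last (block w' \<tau> c \<sigma> w)) = 2" using f(2,4) by (simp add: block_def)
  show "(fst x = 1 \<or> fst x = -1) \<and> snd x \<in> \<int> \<and> 1 \<le> snd x" if "x \<in> set (block w' \<tau> c \<sigma> w)" for x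
    using that f(5)[of x] sw[of x] assms unfolding block_def by auto
  show "snd (block w' \<tau> c \<sigma> w ! i) \<le> 3 \<or> i = Suc (length w')" if i: "i < length (block w' \<tau> c \<sigma> w)" for i
  proof -
    consider "i = 0" | j where "i = Suc j" "j < length w'" | "i = Suc (length w')"
      | j where "i = Suc (length w') + Suc j" "j < length (outward \<sigma> (rev w))"
    proof -
      have "i < Suc (length w') + Suc (length (outward \<sigma> (rev w)))" using i by (simp add: block_def)
      then have len: "i < Suc (length w') + Suc (length (outward \<sigma> (rev w)))" .
      consider "i = 0" | "0 < i" "i < Suc (length w')" | "i = Suc (length w')" | "Suc (length w') < i"
        by linarith
      then show ?thesis
      proof cases
        case 1
        then show ?thesis by (rule that(1))
      next
        case 2
        then show ?thesis by (intro that(2)[of "i - 1"]) auto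
      next
        case 3
        then show ?thesis by (rule that(3))
      next
        case 4
        then show ?thesis using len by (intro that(4)[of "i - Suc (Suc (length w'))"]) auto
      qed
    qed
    then show ?thesis
    proof cases
      case (2 j)
      then have "block w' \<tau> c \<sigma> w ! i = map prod.swap w' ! j" by (simp add: block_def nth_append)
      moreover have "map prod.swap w' ! j \<in> set (map prod.swap w')" using 2 by (intro nth_mem) simp
      ultimately show ?thesis using sw by fastforce
    next
      case (4 j)
      then have "block w' \<tau> c \<sigma> w ! i = outward \<sigma> (rev w) ! j" by (simp add: block_def nth_append)
      moreover have "outward \<sigma> (rev w) ! j \<in> set (outward \<sigma> (rev w))" using 4 by (intro nth_mem)
      ultimately show ?thesis using f(5) by fastforce
    qed (simp_all add: block_def)
  qed
qed

text \<open>The central digits of the blocks are the only digits exceeding 3, and the value at the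
  centre of block \<open>k\<close> is within \<open>sqrt 2 / (k + 1)\<close> of \<open>m\<close>.\<close>

lemma ray_in_Lagrange:
  assumes m: "4 * sqrt 2 \<le> m"
  shows "m \<in> Lagrange_spectrum"
proof -
  define \<mu> where "\<mu> = m / sqrt 2"
  have mu: "4 \<le> \<mu>" using m by (simp add: \<mu>_def field_simps)
  have m_mu: "m = sqrt 2 * \<mu>" by (simp add: \<mu>_def)
  obtain c :: int and \<sigma> \<tau> :: real where c: "4 \<le> c" and \<sigma>: "\<sigma> = 1 \<or> \<sigma> = -1" and \<tau>: "\<tau> = 1 \<or> \<tau> = -1"
    and words: "\<forall>\<epsilon>>0. \<exists>w w'. set w \<subseteq> letters \<and> set w' \<subseteq> letters \<and>
       (\<forall>y y'. 59/50 \<le> y \<longrightarrow> y \<le> 141/50 \<longrightarrow> 59/50 \<le> y' \<longrightarrow> y' \<le> 141/50 \<longrightarrow>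
         \<bar>\<mu> - (of_int c + \<sigma> * cyl w y + \<tau> * cyl w' y')\<bar> \<le> \<epsilon>)"
    by (rule cantor_ray[OF mu])
  have "\<forall>k. \<exists>ww. set (fst ww) \<subseteq> letters \<and> set (snd ww) \<subseteq> letters \<and>
       (\<forall>y y'. 59/50 \<le> y \<longrightarrow> y \<le> 141/50 \<longrightarrow> 59/50 \<le> y' \<longrightarrow> y' \<le> 141/50 \<longrightarrow>
         \<bar>\<mu> - (of_int c + \<sigma> * cyl (fst ww) y + \<tau> * cyl (snd ww) y')\<bar> \<le> 1 / (real k + 1))"
  proof
    fix k
    have "0 < 1 / (real k + 1)" by simp
    from words[rule_format, OF this] show "\<exists>ww. set (fst ww) \<subseteq> letters \<and> set (snd ww) \<subseteq> letters \<and>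
       (\<forall>y y'. 59/50 \<le> y \<longrightarrow> y \<le> 141/50 \<longrightarrow> 59/50 \<le> y' \<longrightarrow> y' \<le> 141/50 \<longrightarrow>
         \<bar>\<mu> - (of_int c + \<sigma> * cyl (fst ww) y + \<tau> * cyl (snd ww) y')\<bar> \<le> 1 / (real k + 1))" by force
  qed
  from choice[OF this] obtain ww where ww: "\<forall>k. set (fst (ww k)) \<subseteq> letters \<and> set (snd (ww k)) \<subseteq> letters \<and>
       (\<forall>y y'. 59/50 \<le> y \<longrightarrow> y \<le> 141/50 \<longrightarrow> 59/50 \<le> y' \<longrightarrow> y' \<le> 141/50 \<longrightarrow>
         \<bar>\<mu> - (of_int c + \<sigma> * cyl (fst (ww k)) y + \<tau> * cyl (snd (ww k)) y')\<bar> \<le> 1 / (real k + 1))" ..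
  define w w' where "w k = fst (ww k)" "w' k = snd (ww k)" for k
  have W: "set (w k) \<subseteq> letters" "set (w' k) \<subseteq> letters" for k using ww by (auto simp: w_w'_def)
  have near: "\<bar>\<mu> - (of_int c + \<sigma> * cyl (w k) y + \<tau> * cyl (w' k) y')\<bar> \<le> 1 / (real k + 1)"
    if "59/50 \<le> y" "y \<le> 141/50" "59/50 \<le> y'" "y' \<le> 141/50" for k y y'
    using ww that by (simp add: w_w'_def)
  define B where "B k = block (w' k) \<tau> (of_int c) \<sigma> (w k)" for k
  have c': "4 \<le> (of_int c :: real)" "of_int c \<in> (\<int> :: real set)" using c by auto
  have BP: "successively compatible (B k)" "snd (last (B k)) = 2"
    "x \<in> set (B k) \<Longrightarrow> (fst x = 1 \<or> fst x = -1) \<and> snd x \<in> \<int> \<and> 1 \<le> snd x"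
    "i < length (B k) \<Longrightarrow> snd (B k ! i) \<le> 3 \<or> i = Suc (length (w' k))" for k x i
    unfolding B_def by (fact block_props[OF W(1)[of k] W(2)[of k] \<sigma> \<tau> c'])+
  have B_ne: "B k \<noteq> []" for k by (simp add: B_def block_def)
  have B_hd: "B k ! 0 = (1, 2)" for k by (simp add: B_def block_def)
  obtain s :: "nat \<Rightarrow> real \<times> real" and st :: "nat \<Rightarrow> nat" where st: "st 0 = 0" "\<And>k. st (Suc k) = st k + length (B k)"
    and s: "\<And>k i. i < length (B k) \<Longrightarrow> s (st k + i) = B k ! i"
    using concat_blocks[of B, OF B_ne] by blast
  define e a where "e n = fst (s n)" "a n = snd (s n)" for n
  have idx: "\<exists>k i. n = st k + i \<and> i < length (B k)" for n
  proof -
    have "0 < length (B k)" for k using B_ne by simp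
    then show ?thesis by (rule block_index[of st "\<lambda>k. length (B k)" n, OF st])
  qed
  have letter: "(e n = 1 \<or> e n = -1) \<and> a n \<in> \<int> \<and> 1 \<le> a n" for n
  proof -
    obtain k i where "n = st k + i" "i < length (B k)" using idx by blast
    then have "s n \<in> set (B k)" using s by auto
    then show ?thesis using BP(3)[of "s n" k] by (simp add: e_a_def)
  qed
  have compatible: "compatible (s n) (s (Suc n))" for n
  proof -
    obtain k i where n: "n = st k + i" "i < length (B k)" using idx by blast
    show ?thesis
    proof (cases "Suc i < length (B k)")
      case True
      then have "compatible (B k ! i) (B k ! Suc i)" using successively_nth[OF BP(1)[of k]] by blast
      then show ?thesis using s[OF n(2)] s[OF True] n(1) by simp
    next
      case False
      then have i: "i = length (B k) - 1" "Suc i = length (B k)" using n(2) by auto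
      then have "s n = last (B k)" using s[OF n(2)] n(1) B_ne by (simp add: last_conv_nth)
      then obtain f where "s n = (f, 2)" using BP(2)[of k] by (metis prod.collapse)
      moreover have "s (Suc n) = (1, 2)"
      proof -
        have "Suc n = st (Suc k) + 0" using n(1) i(2) st(2)[of k] by simp
        then show ?thesis using s[of 0 "Suc k"] B_ne[of "Suc k"] B_hd[of "Suc k"] by simp
      qed
      ultimately show ?thesis by (simp add: compatible_def)
    qed
  qed
  interpret digits a e
  proof
    fix n
    show "a n \<in> \<int>" "1 \<le> a n" "e n = 1 \<or> e n = -1" using letter by auto
    show "e 0 = 1" using s[of 0 0] st(1) B_ne[of 0] B_hd[of 0] by (simp add: e_a_def)
    show "\<not> (a n = 1 \<and> a (Suc n) = 1)" if "e (Suc n) = -1"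
      using compatible[of n] that by (auto simp: compatible_def e_a_def split: prod.splits)
    show False if "a n = 1" "e n = -1" "e (Suc n) = -1"
      using compatible[of n] that by (auto simp: compatible_def e_a_def split: prod.splits)
    show "e n = -1 \<or> e (Suc n) = -1" if "a n = 3"
      using compatible[of n] that by (auto simp: compatible_def e_a_def split: prod.splits)
  qed
  define ct where "ct k = st k + Suc (length (w' k))" for k
  have ct_near: "\<bar>\<mu> - spot (ct k)\<bar> \<le> 1 / (real k + 1)" for k
  proof -
    have at: "(e (st k + i), a (st k + i)) = B k ! i" if "i < length (B k)" for i
      using s[OF that] by (simp add: e_a_def)
    have len: "length (B k) = Suc (Suc (length (w' k) + length (outward \<sigma> (rev (w k)))))"
      by (simp add: B_def block_def)
    have "a (st k) = 2" using at[of 0] B_hd[of k] B_ne[of k] by simp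
    moreover have "(a (Suc (st k) + i), e (Suc (st k) + i)) = w' k ! i" if "i < length (w' k)" for i
    proof -
      have "(e (st k + Suc i), a (st k + Suc i)) = prod.swap (w' k ! i)"
        using at[of "Suc i"] that len by (simp add: B_def block_def nth_append)
      then show ?thesis by (cases "w' k ! i") auto
    qed
    ultimately obtain y' where y': "59/50 \<le> y'" "y' \<le> 141/50" "past (Suc (st k) + length (w' k)) = cfrac (rev (w' k)) y'"
      using past_inward[of "st k" "w' k"] past_two[of "st k"] by blast
    have past: "past (ct k) = cyl (w' k) y'" using y' W cyl_cfrac by (simp add: ct_def)
    have ctr: "e (ct k) = \<tau>" "a (ct k) = of_int c"
      using at[of "Suc (length (w' k))"] len by (simp_all add: ct_def B_def block_def nth_append)
    have "(e (Suc (ct k) + i), a (Suc (ct k) + i)) = outward \<sigma> (rev (w k)) ! i"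
      if "i < length (outward \<sigma> (rev (w k)))" for i
      using at[of "Suc (Suc (length (w' k) + i))"] that len
      by (simp add: ct_def B_def block_def nth_append add.assoc)
    note F = this
    obtain y where y: "59/50 \<le> y" "y \<le> 141/50" "tail (Suc (ct k)) = cfrac (rev (w k)) y"
      using tail_outward[OF F] by blast
    have "e (Suc (ct k)) = \<sigma>"
      using F[of 0] outward_props(2,3)[of "rev (w k)" \<sigma>] W \<sigma> by (simp add: hd_conv_nth) (metis fst_conv)
    then have "spot (ct k) = of_int c + \<sigma> * cyl (w k) y + \<tau> * cyl (w' k) y'"
      using y W cyl_cfrac by (simp add: spot_def growth_def ctr past)
    then show ?thesis using near[OF y(1,2) y'(1,2), of k] by simp
  qed
  have ct_less: "ct k < ct (Suc k)" for k
    using st(2)[of k] by (simp add: ct_def B_def block_def)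
  then have ct_inj: "inj ct" by (intro strict_mono_imp_inj_on) (simp add: strict_mono_Suc_iff)
  have centre: "a n \<le> 3 \<or> (\<exists>k. n = ct k)" for n
  proof -
    obtain k i where n: "n = st k + i" "i < length (B k)" using idx by blast
    show ?thesis using BP(4)[of i k, OF n(2)] s[OF n(2)] n(1) by (auto simp: e_a_def ct_def)
  qed
  have "Lagrange_value xi = ereal m"
  proof (rule Lagrange_value_xi[OF m])
    fix L assume L: "m < L"
    obtain N :: nat where N: "sqrt 2 / (L - m) < real N" using reals_Archimedean2 by blast
    have "{n. L < sqrt 2 * spot n} \<subseteq> ct ` {..N}"
    proof
      fix n assume "n \<in> {n. L < sqrt 2 * spot n}"
      then have n: "L < sqrt 2 * spot n" by simp
      have "\<not> a n \<le> 3"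
      proof
        assume "a n \<le> 3"
        then have "sqrt 2 * spot n \<le> sqrt 2 * 4" using spot_le[of n] by (intro mult_left_mono) auto
        then show False using n L m by linarith
      qed
      then obtain k where k: "n = ct k" using centre by blast
      have "sqrt 2 * spot n \<le> sqrt 2 * (\<mu> + 1 / (real k + 1))"
        using ct_near[of k] by (intro mult_left_mono) (auto simp: k abs_le_iff)
      then have "L - m < sqrt 2 / (real k + 1)" using n by (simp add: m_mu distrib_left)
      then have "real k + 1 < sqrt 2 / (L - m)" using L by (simp add: field_simps)
      then have "k \<le> N" using N by linarith
      then show "n \<in> ct ` {..N}" using k by simp
    qed
    then show "finite {n. L < sqrt 2 * spot n}" by (rule finite_subset) simp
  next
    fix L assume L: "L < m"
    obtain N :: nat where N: "sqrt 2 / (m - L) < real N" using reals_Archimedean2 by blast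
    have "ct ` {N..} \<subseteq> {n. L < sqrt 2 * spot n}"
    proof (clarsimp)
      fix k assume "N \<le> k"
      then have "sqrt 2 / (m - L) < real k + 1" using N by linarith
      then have "sqrt 2 / (real k + 1) < m - L" using L by (simp add: field_simps)
      moreover have "sqrt 2 * (\<mu> - 1 / (real k + 1)) \<le> sqrt 2 * spot (ct k)"
        using ct_near[of k] by (intro mult_left_mono) (auto simp: abs_le_iff)
      ultimately show "L < sqrt 2 * spot (ct k)" by (simp add: m_mu right_diff_distrib)
    qed
    moreover have "infinite (ct ` {N..})"
      using finite_imageD[of ct "{N..}"] ct_inj inj_on_subset infinite_Ici by blast
    ultimately show "infinite {n. L < sqrt 2 * spot n}" using infinite_super by blast
  qed
  then show ?thesis unfolding Lagrange_spectrum_def using xi_irrational by blast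
qed

theorem theorem1p4:
  "{4 * sqrt 2..} \<subseteq> Lagrange_spectrum \<and> Lagrange_spectrum \<subseteq> Markoff_spectrum"
  using ray_in_Lagrange Lagrange_subset_Markoff by auto

end
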